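(* For every positive integer $m$ there exists a constant $\gamma_0>0$ depending only on $m$ such that the following holds. Let $(X,d)$ be a metric tree, let $Y$ be a Banach space, and let $\lambda$ be a positive constant. Let $F:X\to\mathrm{Conv}_m(Y)$ be a set-valued mapping such that, for every subset $X'\subset X$ with $\#X'\le k^\sharp$, the restriction $F|_{X'}$ has a Lipschitz selection $f_{X'}:X'\to Y$ with $\|f_{X'}\|_{\mathrm{Lip}(X',Y)}\le\lambda$. Then $F$ has a Lipschitz selection $f:X\to Y$ with $\|f\|_{\mathrm{Lip}(X,Y)}\le\gamma_0\lambda$. Here $k^\sharp=(m+2)^{3m+3}$.
   Context: A metric tree: let $T=(X,E)$ be a finite (graph-theoretic) tree with node set $X$ and edge set $E$, and assign a number $\Delta(e)>0$ to each edge $e\in E$. Set $d(x,x)=0$, and for distinct $x,y\in X$ let $d(x,y)$ be the sum of $\Delta(e)$ over the edges $e$ of the unique path of distinct nodes joining $x$ to $y$. The metric space $(X,d)$ is called a metric tree. $\mathrm{Conv}_m(Y)$ is the family of all nonempty convex subsets of $Y$ of dimension at most $m$ (contained in an affine subspace of dimension at most $m$). A Lipschitz selection of $F$ on a set is a Lipschitz map $f$ into $Y$ with $f(x)\in F(x)$ for all $x$ in that set. $\|f\|_{\mathrm{Lip}(X,Y)}=\inf\{\lambda>0:\|f(x)-f(y)\|\le\lambda d(x,y)\text{ for all }x,y\in X\}$. *)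

theory Defs
  imports "HOL-Analysis.Analysis"
begin

fun path_edges :: "'a list \<Rightarrow> 'a set list" where
  "path_edges (u # v # p) = {u, v} # path_edges (v # p)"
| "path_edges _ = []"

definition simple_path :: "'a set \<Rightarrow> 'a set set \<Rightarrow> 'a \<Rightarrow> 'a list \<Rightarrow> 'a \<Rightarrow> bool" where
  "simple_path X E x p y \<longleftrightarrow>
     p \<noteq> [] \<and> hd p = x \<and> last p = y \<and> distinct p \<and> set p \<subseteq> X \<and> set (path_edges p) \<subseteq> E"

definition graph_cycle :: "'a set set \<Rightarrow> 'a list \<Rightarrow> bool" where
  "graph_cycle E p \<longleftrightarrow>
     3 \<le> length p \<and> distinct p \<and> set (path_edges p) \<subseteq> E \<and> {last p, hd p} \<in> E"

definition finite_tree :: "'a set \<Rightarrow> 'a set set \<Rightarrow> bool" where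
  "finite_tree X E \<longleftrightarrow>
     finite X \<and> X \<noteq> {} \<and> (\<forall>e\<in>E. e \<subseteq> X \<and> card e = 2) \<and>
     (\<forall>x\<in>X. \<forall>y\<in>X. \<exists>p. simple_path X E x p y) \<and> \<not> (\<exists>p. graph_cycle E p)"

definition tree_dist :: "'a set \<Rightarrow> 'a set set \<Rightarrow> ('a set \<Rightarrow> real) \<Rightarrow> 'a \<Rightarrow> 'a \<Rightarrow> real" where
  "tree_dist X E \<Delta> x y =
     (if x = y then 0
      else sum_list (map \<Delta> (path_edges (THE p. simple_path X E x p y))))"

definition Conv :: "nat \<Rightarrow> 'b::real_vector set set" where
  "Conv m = {S. S \<noteq> {} \<and> convex S \<and>
     (\<exists>a B. finite B \<and> independent B \<and> card B \<le> m \<and> S \<subseteq> {a + v |v. v \<in> span B})}"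

definition lip_consts ::
  "'a set \<Rightarrow> ('a \<Rightarrow> 'a \<Rightarrow> real) \<Rightarrow> ('a \<Rightarrow> 'b::real_normed_vector) \<Rightarrow> real set" where
  "lip_consts S d f = {c. c > 0 \<and> (\<forall>x\<in>S. \<forall>y\<in>S. norm (f x - f y) \<le> c * d x y)}"

definition lip_norm ::
  "'a set \<Rightarrow> ('a \<Rightarrow> 'a \<Rightarrow> real) \<Rightarrow> ('a \<Rightarrow> 'b::real_normed_vector) \<Rightarrow> real" where
  "lip_norm S d f = Inf (lip_consts S d f)"

definition lip_selection ::
  "'a set \<Rightarrow> ('a \<Rightarrow> 'a \<Rightarrow> real) \<Rightarrow> ('a \<Rightarrow> 'b::real_normed_vector set) \<Rightarrow> ('a \<Rightarrow> 'b) \<Rightarrow> bool" where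
  "lip_selection S d F f \<longleftrightarrow> lip_consts S d f \<noteq> {} \<and> (\<forall>x\<in>S. f x \<in> F x)"

definition k_sharp :: "nat \<Rightarrow> nat" where
  "k_sharp m = (m + 2) ^ (3 * m + 3)"

(* The constant must depend on m alone, but a HOL formula cannot put the quantification over
   the node type and the Banach space inside the scope of "there is a gamma". An existential
   quantifier in a theorem about types 'a and 'b::banach would let the constant vary with 'a
   and 'b. So the constant is fixed here as a function of m: any positive constant that works
   for the trees with nodes in nat and for the Banach space of bounded real sequences (bounded
   continuous functions on the discrete space nat, with the sup norm). This loses nothing: the
   values of F lie in a finite-dimensional subspace, because trees are finite, and every
   finite-dimensional normed space embeds isometrically in that space. Hence some constant
   works for all trees and all Banach spaces if and only if gamma0 does. *)
definition gamma0 :: "nat \<Rightarrow> real" where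
  "gamma0 m = (SOME \<gamma>. \<gamma> > 0 \<and>
     (\<forall>(X :: nat set) E \<Delta> (F :: nat \<Rightarrow> (nat \<Rightarrow>\<^sub>C real) set) L.
        finite_tree X E \<longrightarrow> (\<forall>e\<in>E. \<Delta> e > 0) \<longrightarrow> L > 0 \<longrightarrow>
        (\<forall>x\<in>X. F x \<in> Conv m) \<longrightarrow>
        (\<forall>X'\<subseteq>X. card X' \<le> k_sharp m \<longrightarrow>
           (\<exists>f. lip_selection X' (tree_dist X E \<Delta>) F f \<and>
                lip_norm X' (tree_dist X E \<Delta>) f \<le> L)) \<longrightarrow>
        (\<exists>f. lip_selection X (tree_dist X E \<Delta>) F f \<and>
             lip_norm X (tree_dist X E \<Delta>) f \<le> \<gamma> * L)))"

end

theory Submission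
  imports Defs
begin

text \<open>The proof is by induction on \<open>m\<close>, for set-valued maps into bounded sequences. Let \<open>\<Gamma> x\<close> be the
  set of the values at \<open>x\<close> that extend to a selection on each small set of nodes. If \<open>\<Gamma> x\<close> contains a
  segment of length \<open>r\<close>, take a functional \<open>\<phi>\<close> that almost attains its norm on this segment. Fixing
  the value of \<open>\<phi>\<close> cuts the dimension of all \<open>F z\<close> with \<open>z\<close> in a ball of radius
  proportional to \<open>r\<close>, and the smaller sets still satisfy the finiteness hypothesis: selections through
  the two end points of the segment can be interpolated, with Lipschitz weights. The induction
  hypothesis thus gives a selection on this ball. The radius is chosen as the largest Lipschitz
  function \<open>r\<close> below the diameter of \<open>\<Gamma>\<close>. Near each \<open>x\<close> there is then some \<open>\<Gamma> x'\<close> of diameter at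
  most \<open>r x\<close>, which forces the selections on neighbouring balls to be close to each other, by Helly's theorem. They are
  glued along the tree.

  An isometry into bounded sequences, from finite-dimensional Hahn-Banach and separability,
  passes from this case to an arbitrary Banach space.\<close>

subsection \<open>Tree metrics\<close>

text \<open>The edges are forgotten. What remains is an order in which the nodes can be attached as
  leaves, so that arguments about trees become inductions over this order. All distances from a new
  leaf \<open>z\<close> pass through its neighbour \<open>p\<close>.\<close>

inductive tree_metric :: "('a \<Rightarrow> 'a \<Rightarrow> real) \<Rightarrow> 'a set \<Rightarrow> bool" for d where
  single: "d x x = 0 \<Longrightarrow> tree_metric d {x}"
| leaf: "\<lbrakk>tree_metric d X; p \<in> X; z \<notin> X; d z z = 0; 0 < d z p;
    \<And>y. y \<in> X \<Longrightarrow> d z y = d z p + d p y; \<And>y. y \<in> X \<Longrightarrow> d y z = d z y\<rbrakk>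
    \<Longrightarrow> tree_metric d (insert z X)"

lemma tree_metric_finite: "tree_metric d X \<Longrightarrow> finite X"
  by (induction rule: tree_metric.induct) blast+

lemma tree_metric_nonempty: "tree_metric d X \<Longrightarrow> X \<noteq> {}"
  by (induction rule: tree_metric.induct) blast+

lemma tree_metric_refl: "tree_metric d X \<Longrightarrow> x \<in> X \<Longrightarrow> d x x = 0"
  by (induction rule: tree_metric.induct) blast+

lemma tree_metric_sym: "tree_metric d X \<Longrightarrow> x \<in> X \<Longrightarrow> y \<in> X \<Longrightarrow> d x y = d y x"
proof (induction arbitrary: x y rule: tree_metric.induct)
  case (leaf X p z)
  from leaf.prems consider "x \<in> X" "y \<in> X" | "x = z" "y \<in> X" | "x \<in> X" "y = z" | "x = z" "y = z"
    by blast
  then show ?case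
  proof cases
    case 1
    then show ?thesis by (rule leaf.IH)
  next
    case 2
    then show ?thesis using leaf.hyps(7)[of y] by simp
  next
    case 3
    then show ?thesis using leaf.hyps(7)[of x] by simp
  qed simp
qed simp

lemma tree_metric_pos: "tree_metric d X \<Longrightarrow> x \<in> X \<Longrightarrow> y \<in> X \<Longrightarrow> x \<noteq> y \<Longrightarrow> 0 < d x y"
proof (induction arbitrary: x y rule: tree_metric.induct)
  case (leaf X p z)
  have z: "0 < d z v" if "v \<in> X" for v
  proof (cases "v = p")
    case False
    then have "0 < d p v"
      using leaf.IH[OF leaf.hyps(2) that] by simp
    then show ?thesis
      using leaf.hyps(5) leaf.hyps(6)[OF that] by linarith
  qed (use leaf.hyps(5) in simp)
  from leaf.prems consider "x \<in> X" "y \<in> X" | "x = z" "y \<in> X" | "x \<in> X" "y = z"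
    by blast
  then show ?case
  proof cases
    case 1
    then show ?thesis using leaf.prems(3) by (rule leaf.IH)
  next
    case 2
    then show ?thesis using z[of y] by simp
  next
    case 3
    then show ?thesis using z[of x] leaf.hyps(7)[of x] by simp
  qed
qed simp

lemma tree_metric_nonneg: "tree_metric d X \<Longrightarrow> x \<in> X \<Longrightarrow> y \<in> X \<Longrightarrow> 0 \<le> d x y"
  using tree_metric_pos[of d X x y] tree_metric_refl[of d X x] by (cases "x = y") auto

lemma tree_metric_triangle:
  "tree_metric d X \<Longrightarrow> x \<in> X \<Longrightarrow> y \<in> X \<Longrightarrow> w \<in> X \<Longrightarrow> d x w \<le> d x y + d y w"
proof (induction arbitrary: x y w rule: tree_metric.induct)
  case (leaf X p z)
  note X = leaf.hyps(1) and p = leaf.hyps(2)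
  note zy = leaf.hyps(6) and yz = leaf.hyps(7)
  show ?case
  proof (cases "x = z"; cases "y = z"; cases "w = z")
    assume *: "x = z" "y \<noteq> z" "w = z"
    then have y: "y \<in> X" using leaf.prems by simp
    show ?thesis
      using zy[OF y] yz[OF y] tree_metric_nonneg[OF X p y] leaf.hyps(4,5)
      unfolding * by linarith
  next
    assume *: "x = z" "y \<noteq> z" "w \<noteq> z"
    then have y: "y \<in> X" and w: "w \<in> X" using leaf.prems by simp_all
    show ?thesis
      using zy[OF y] zy[OF w] leaf.IH[OF p y w]
      unfolding * by linarith
  next
    assume *: "x \<noteq> z" "y = z" "w \<noteq> z"
    then have x: "x \<in> X" and w: "w \<in> X" using leaf.prems by simp_all
    show ?thesis
      using zy[OF x] yz[OF x] zy[OF w] leaf.IH[OF x p w] tree_metric_sym[OF X p x] leaf.hyps(5)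
      unfolding * by linarith
  next
    assume *: "x \<noteq> z" "y \<noteq> z" "w = z"
    then have x: "x \<in> X" and y: "y \<in> X" using leaf.prems by simp_all
    show ?thesis
      using zy[OF x] yz[OF x] zy[OF y] yz[OF y] leaf.IH[OF p y x] tree_metric_sym[OF X x y]
      unfolding * by linarith
  next
    assume "x \<noteq> z" "y \<noteq> z" "w \<noteq> z"
    then show ?thesis using leaf.prems by (intro leaf.IH) simp_all
  qed (simp_all add: leaf.hyps(4))
qed simp

lemma tree_metric_scale:
  assumes "tree_metric d X" "c > 0"
  shows "tree_metric (\<lambda>x y. c * d x y) X"
  using assms(1)
proof (induction rule: tree_metric.induct)
  case (leaf X p z)
  show ?case
  proof (rule tree_metric.leaf[OF leaf.IH leaf.hyps(2,3)])
    show "c * d z y = c * d z p + c * d p y" if "y \<in> X" for y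
      using leaf.hyps(6)[OF that] by (simp add: distrib_left)
    show "c * d y z = c * d z y" if "y \<in> X" for y
      using leaf.hyps(7)[OF that] by simp
  qed (use leaf.hyps(4,5) assms(2) in auto)
qed (auto intro: tree_metric.single)

text \<open>The induction on the dimension is applied on balls. Centre and radius are generalized,
  because a ball around the new leaf \<open>z\<close> consists of \<open>z\<close> and, if it
  reaches \<open>p\<close>, a smaller ball around \<open>p\<close>.\<close>

lemma tree_metric_ball:
  "tree_metric d X \<Longrightarrow> x \<in> X \<Longrightarrow> 0 \<le> r \<Longrightarrow> tree_metric d {z \<in> X. d x z \<le> r}"
proof (induction arbitrary: x r rule: tree_metric.induct)
  case (single a)
  then have "{z \<in> {a}. d x z \<le> r} = {a}" by auto
  then show ?case
    using single tree_metric.single by metis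
next
  case (leaf X p z)
  note X = leaf.hyps(1)
  show ?case
  proof (cases "x = z")
    case True
    show ?thesis
    proof (cases "d z p \<le> r")
      case True
      have eq: "{y \<in> insert z X. d x y \<le> r} = insert z {y \<in> X. d p y \<le> r - d z p}"
        using leaf.hyps(6) leaf.prems(2) unfolding \<open>x = z\<close> by (force simp: leaf.hyps(4))
      show ?thesis
        unfolding eq
      proof (rule tree_metric.leaf[where p = p])
        show "tree_metric d {y \<in> X. d p y \<le> r - d z p}"
          by (rule leaf.IH) (use leaf.hyps(2) True in auto)
        show "p \<in> {y \<in> X. d p y \<le> r - d z p}"
          using leaf.hyps(2) True tree_metric_refl[OF X] by simp
      qed (use leaf.hyps(3-7) in blast)+
    next
      case False
      have "r < d z y" if "y \<in> X" for y
        using leaf.hyps(6)[OF that] tree_metric_nonneg[OF X \<open>p \<in> X\<close> that] False by linarith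
      then have "{y \<in> insert z X. d x y \<le> r} = {z}"
        using leaf.prems(2) unfolding \<open>x = z\<close> by (force simp: leaf.hyps(4))
      then show ?thesis
        using tree_metric.single[of d z, OF leaf.hyps(4)] by simp
    qed
  next
    case False
    then have x: "x \<in> X" using leaf.prems by auto
    have xz: "d x z = d z p + d x p"
      using leaf.hyps(6,7)[OF x] tree_metric_sym[OF X x \<open>p \<in> X\<close>] by simp
    show ?thesis
    proof (cases "d x z \<le> r")
      case True
      then have eq: "{y \<in> insert z X. d x y \<le> r} = insert z {y \<in> X. d x y \<le> r}" by auto
      show ?thesis
        unfolding eq
      proof (rule tree_metric.leaf[where p = p])
        show "tree_metric d {y \<in> X. d x y \<le> r}"
          by (rule leaf.IH[OF x leaf.prems(2)])
        show "p \<in> {y \<in> X. d x y \<le> r}"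
          using True xz leaf.hyps(2,5) by simp
      qed (use leaf.hyps(3-7) in blast)+
    next
      case False
      then have "{y \<in> insert z X. d x y \<le> r} = {y \<in> X. d x y \<le> r}" by auto
      then show ?thesis using leaf.IH[OF x leaf.prems(2)] by simp
    qed
  qed
qed

text \<open>The map is built leaf by leaf from states \<open>s\<close>, which may carry more data
  than the value \<open>v x s\<close>. Control of the single step from \<open>p\<close> to the new
  leaf is enough, since all distances from the leaf are sums through \<open>p\<close>.\<close>

lemma tree_greedy:
  fixes v :: "'a \<Rightarrow> 's \<Rightarrow> 'b::real_normed_vector"
  assumes "tree_metric d X"
    and "\<And>x. x \<in> X \<Longrightarrow> \<exists>s. I x s"
    and "\<And>p z s. p \<in> X \<Longrightarrow> z \<in> X \<Longrightarrow> I p s \<Longrightarrow> \<exists>s'. I z s' \<and> norm (v p s - v z s') \<le> c * d p z"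
    and "c \<ge> 0"
  shows "\<exists>\<sigma>. \<forall>x\<in>X. I x (\<sigma> x) \<and> (\<forall>y\<in>X. norm (v x (\<sigma> x) - v y (\<sigma> y)) \<le> c * d x y)"
  using assms(1-3)
proof (induction rule: tree_metric.induct)
  case (single x)
  then obtain s where "I x s" by auto
  then show ?case
    using single by (intro exI[of _ "\<lambda>_. s"]) auto
next
  case (leaf X p z)
  have "\<exists>\<sigma>. \<forall>x\<in>X. I x (\<sigma> x) \<and> (\<forall>y\<in>X. norm (v x (\<sigma> x) - v y (\<sigma> y)) \<le> c * d x y)"
    using leaf.prems by (intro leaf.IH) blast+
  then obtain \<sigma> where \<sigma>: "\<And>x. x \<in> X \<Longrightarrow> I x (\<sigma> x)"
    "\<And>x y. x \<in> X \<Longrightarrow> y \<in> X \<Longrightarrow> norm (v x (\<sigma> x) - v y (\<sigma> y)) \<le> c * d x y"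
    by blast
  obtain s where s: "I z s" "norm (v p (\<sigma> p) - v z s) \<le> c * d p z"
    using leaf.prems(2)[of p z "\<sigma> p"] leaf.hyps(2) \<sigma>(1) by blast
  have zy: "norm (v z s - v y (\<sigma> y)) \<le> c * d z y" if "y \<in> X" for y
  proof -
    have "v z s - v y (\<sigma> y) = (v p (\<sigma> p) - v y (\<sigma> y)) - (v p (\<sigma> p) - v z s)" by simp
    then have "norm (v z s - v y (\<sigma> y)) \<le> norm (v p (\<sigma> p) - v y (\<sigma> y)) + norm (v p (\<sigma> p) - v z s)"
      by (metis norm_triangle_ineq4)
    also have "\<dots> \<le> c * d p y + c * d p z"
      using \<sigma>(2)[OF leaf.hyps(2) that] s(2) by simp
    also have "\<dots> = c * d z y"
      using leaf.hyps(6)[OF that] leaf.hyps(7)[OF leaf.hyps(2)] by (simp add: algebra_simps)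
    finally show ?thesis .
  qed
  then have yz: "norm (v y (\<sigma> y) - v z s) \<le> c * d y z" if "y \<in> X" for y
    using that leaf.hyps(7)[OF that] by (simp add: norm_minus_commute)
  show ?case
  proof (intro exI ballI conjI)
    let ?\<tau> = "\<sigma>(z := s)"
    fix x assume x: "x \<in> insert z X"
    show "I x (?\<tau> x)" using x s \<sigma> by auto
    fix y assume y: "y \<in> insert z X"
    show "norm (v x (?\<tau> x) - v y (?\<tau> y)) \<le> c * d x y"
      using x y \<sigma>(2) zy yz leaf.hyps(3,4) by auto
  qed
qed

subsection \<open>Helly's theorem in an affine subspace\<close>

lemma affine_dependent_if_card_gt:
  assumes "finite B" "finite S" "S \<subseteq> {a + v |v. v \<in> span B}" "card S > card B + 1"
  shows "affine_dependent S"
proof (rule ccontr)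
  assume ind: "\<not> affine_dependent S"
  obtain s where s: "s \<in> S" using assms(4) by fastforce
  define D where "D = (\<lambda>x. - s + x) ` (S - {s})"
  have "independent D"
    using ind affine_dependent_iff_dependent[of s "S - {s}"] s by (simp add: D_def insert_absorb)
  moreover have "D \<subseteq> span B"
  proof
    fix y assume "y \<in> D"
    then obtain x where "x \<in> S" "y = x - s" by (auto simp: D_def)
    then obtain u v where "u \<in> span B" "v \<in> span B" "y = (a + u) - (a + v)"
      using assms(3) s by blast
    then show "y \<in> span B" by (simp add: span_diff)
  qed
  ultimately have "card D \<le> card B"
    using independent_span_bound[OF assms(1)] by blast
  moreover have "card D = card S - 1"
    unfolding D_def using s assms(2) by (subst card_image) (auto simp: inj_on_def)
  ultimately show False using assms(4) by simp
qed

text \<open>Induction on the number of sets, by Radon's theorem. The dimension is that of a common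
  affine subspace, since the surrounding space may have infinite dimension.\<close>

theorem helly_affine:
  fixes A :: "'i \<Rightarrow> 'b::real_vector set"
  assumes "finite B" "finite I"
    and "\<And>i. i \<in> I \<Longrightarrow> convex (A i) \<and> A i \<subseteq> {a + v |v. v \<in> span B}"
    and "\<And>J. J \<subseteq> I \<Longrightarrow> card J \<le> card B + 1 \<Longrightarrow> (\<Inter>i\<in>J. A i) \<noteq> {}"
  shows "(\<Inter>i\<in>I. A i) \<noteq> {}"
  using assms(2-4)
proof (induction "card I" arbitrary: I rule: less_induct)
  case (less I)
  show ?case
  proof (cases "card I \<le> card B + 1")
    case True
    then show ?thesis using less by blast
  next
    case False
    have "\<exists>x. x \<in> (\<Inter>j\<in>I - {i}. A j)" if "i \<in> I" for i
    proof -
      have "(\<Inter>j\<in>I - {i}. A j) \<noteq> {}"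
      proof (rule less.hyps)
        show "card (I - {i}) < card I"
          using that less.prems(1) by (meson card_Diff1_less)
        show "(\<Inter>j\<in>J. A j) \<noteq> {}" if "J \<subseteq> I - {i}" "card J \<le> card B + 1" for J
          using less.prems(3) that by blast
      qed (use less.prems in auto)
      then show ?thesis by blast
    qed
    then obtain x where x: "\<And>i j. i \<in> I \<Longrightarrow> j \<in> I \<Longrightarrow> i \<noteq> j \<Longrightarrow> x i \<in> A j"
      by (metis DiffI INT_iff empty_iff insert_iff)
    show ?thesis
    proof (cases "inj_on x I")
      case False
      then obtain i j where ij: "i \<in> I" "j \<in> I" "i \<noteq> j" "x i = x j"
        by (auto simp: inj_on_def)
      \<comment> \<open>The point \<open>x i\<close> can miss only \<open>A i\<close>; being equal
        to \<open>x j\<close>, it can miss only \<open>A j\<close>.\<close>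
      then have "x i \<in> A k" if "k \<in> I" for k
        using x that by metis
      then show ?thesis by blast
    next
      case inj: True
      have "\<forall>i\<in>I. x i \<in> {a + v |v. v \<in> span B}"
      proof
        fix i assume "i \<in> I"
        moreover have "I \<noteq> {i}" using False by auto
        ultimately obtain j where "j \<in> I" "j \<noteq> i" by blast
        then show "x i \<in> {a + v |v. v \<in> span B}"
          using x[of i j] less.prems(2)[of j] \<open>i \<in> I\<close> by blast
      qed
      then have "affine_dependent (x ` I)"
        using False inj less.prems(1) assms(1)
        by (intro affine_dependent_if_card_gt[of B]) (auto simp: card_image)
      then obtain M P where MP: "M \<inter> P = {}" "M \<union> P = x ` I"
        "convex hull M \<inter> convex hull P \<noteq> {}"
        using Radon_partition[of "x ` I"] less.prems(1) by blast
      then obtain z where z: "z \<in> convex hull M" "z \<in> convex hull P" by blast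
      \<comment> \<open>The two parts of a Radon partition are disjoint, so one of them avoids
        \<open>x i\<close>. That part, and with it its convex hull, lies in
        \<open>A i\<close>.\<close>
      have sub: "Q \<subseteq> A i" if "i \<in> I" "x i \<notin> Q" "Q \<subseteq> x ` I" for i Q
        using that x by blast
      have "z \<in> A i" if i: "i \<in> I" for i
      proof (cases "x i \<in> M")
        case True
        then have "P \<subseteq> A i" using sub[OF i] MP by blast
        then show ?thesis using z less.prems(2)[OF i] by (meson hull_minimal subsetD)
      next
        case False
        then have "M \<subseteq> A i" using sub[OF i] MP by blast
        then show ?thesis using z less.prems(2)[OF i] by (meson hull_minimal subsetD)
      qed
      then show ?thesis by blast
    qed
  qed
qed

subsection \<open>Lipschitz selections of finite subfamilies\<close>

text \<open>Here \<open>c\<close> is a bound that holds, not an infimum as in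
  \<open>lip_norm\<close>; \<open>lip_norm_le_iff\<close> connects the two.\<close>

definition lipsel ::
  "real \<Rightarrow> 'a set \<Rightarrow> ('a \<Rightarrow> 'a \<Rightarrow> real) \<Rightarrow> ('a \<Rightarrow> 'b::real_normed_vector set) \<Rightarrow> ('a \<Rightarrow> 'b) \<Rightarrow> bool" where
  "lipsel c S d F f \<longleftrightarrow> (\<forall>x\<in>S. f x \<in> F x) \<and> (\<forall>x\<in>S. \<forall>y\<in>S. norm (f x - f y) \<le> c * d x y)"

lemma lipselI:
  "(\<And>x. x \<in> S \<Longrightarrow> f x \<in> F x) \<Longrightarrow> (\<And>x y. x \<in> S \<Longrightarrow> y \<in> S \<Longrightarrow> norm (f x - f y) \<le> c * d x y) \<Longrightarrow>
    lipsel c S d F f"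
  by (simp add: lipsel_def)

lemma lipselD:
  assumes "lipsel c S d F f" "x \<in> S"
  shows "f x \<in> F x" and "y \<in> S \<Longrightarrow> norm (f x - f y) \<le> c * d x y"
  using assms by (auto simp: lipsel_def)

lemma lipsel_subset: "lipsel c S d F f \<Longrightarrow> T \<subseteq> S \<Longrightarrow> lipsel c T d F f"
  by (auto simp: lipsel_def subset_iff)

text \<open>A change of the weight costs only in proportion to the distance between the two blended
  maps. This governs the interpolation of selections as well as the gluing.\<close>

lemma norm_blend_diff_le:
  fixes a a' b b' :: "'b::real_normed_vector"
  assumes "norm (a - a') \<le> e" "norm (b - b') \<le> e" "norm (a - b) \<le> R" "0 \<le> t" "t \<le> 1"
  shows "norm (((1 - s) *\<^sub>R a + s *\<^sub>R b) - ((1 - t) *\<^sub>R a' + t *\<^sub>R b')) \<le> e + \<bar>s - t\<bar> * R"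
proof -
  have "((1 - s) *\<^sub>R a + s *\<^sub>R b) - ((1 - t) *\<^sub>R a' + t *\<^sub>R b')
      = ((1 - t) *\<^sub>R (a - a') + t *\<^sub>R (b - b')) - (s - t) *\<^sub>R (a - b)"
    by (simp add: algebra_simps)
  also have "norm \<dots> \<le> norm ((1 - t) *\<^sub>R (a - a') + t *\<^sub>R (b - b')) + norm ((s - t) *\<^sub>R (a - b))"
    by (rule norm_triangle_ineq4)
  also have "\<dots> \<le> ((1 - t) * norm (a - a') + t * norm (b - b')) + \<bar>s - t\<bar> * norm (a - b)"
    using norm_triangle_ineq[of "(1 - t) *\<^sub>R (a - a')" "t *\<^sub>R (b - b')"] assms(4,5) by simp
  also have "\<dots> \<le> ((1 - t) * e + t * e) + \<bar>s - t\<bar> * R"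
    using assms by (intro add_mono mult_left_mono) auto
  finally show ?thesis by (simp add: algebra_simps)
qed

lemma lipsel_convex_comb:
  assumes "lipsel c S d F f" "lipsel c S d F g" "\<And>x. x \<in> S \<Longrightarrow> convex (F x)" "0 \<le> t" "t \<le> 1"
  shows "lipsel c S d F (\<lambda>x. (1 - t) *\<^sub>R f x + t *\<^sub>R g x)"
proof (rule lipselI)
  fix x assume x: "x \<in> S"
  show "(1 - t) *\<^sub>R f x + t *\<^sub>R g x \<in> F x"
    using assms lipselD(1)[OF _ x] x by (metis convex_alt)
  fix y assume y: "y \<in> S"
  show "norm (((1 - t) *\<^sub>R f x + t *\<^sub>R g x) - ((1 - t) *\<^sub>R f y + t *\<^sub>R g y)) \<le> c * d x y"
    using norm_blend_diff_le[of "f x" "f y" "c * d x y" "g x" "g y" "norm (f x - g x)" t t]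
      lipselD(2)[OF assms(1) x y] lipselD(2)[OF assms(2) x y] assms(4,5) by simp
qed

text \<open>Helly's theorem is applied to the sets of values at \<open>x\<close> of selections on
  \<open>insert x S \<union> Z\<close>. Any \<open>M + 1\<close> sets \<open>S\<close> have together
  with \<open>x\<close> at most \<open>(M + 1) * n + 1\<close> nodes, so one selection serves them
  all. The nodes \<open>Z\<close> and the convex condition \<open>P\<close> allow prescribing values
  at other nodes.\<close>

lemma helly_selection:
  fixes F :: "'a \<Rightarrow> 'b::real_normed_vector set"
  assumes X: "finite X" and F: "\<And>x. x \<in> X \<Longrightarrow> F x \<in> Conv M" and Z: "Z \<subseteq> X" and x: "x \<in> X"
    and P: "\<And>f g t. P f \<Longrightarrow> P g \<Longrightarrow> 0 \<le> t \<Longrightarrow> t \<le> 1 \<Longrightarrow> P (\<lambda>z. (1 - t) *\<^sub>R f z + t *\<^sub>R g z)"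
    and sel: "\<And>S. S \<subseteq> X \<Longrightarrow> card S \<le> (M + 1) * n + 1 \<Longrightarrow> \<exists>f. lipsel c (S \<union> Z) d F f \<and> P f"
  shows "\<exists>y. \<forall>S\<subseteq>X. card S \<le> n \<longrightarrow> (\<exists>f. lipsel c (insert x S \<union> Z) d F f \<and> P f \<and> f x = y)"
proof -
  obtain a B where B: "finite B" "card B \<le> M" "F x \<subseteq> {a + v |v. v \<in> span B}"
    using F[OF x] by (auto simp: Conv_def)
  define I where "I = {S. S \<subseteq> X \<and> card S \<le> n}"
  define A where "A S = {f x |f. lipsel c (insert x S \<union> Z) d F f \<and> P f}" for S
  have "(\<Inter>S\<in>I. A S) \<noteq> {}"
  proof (rule helly_affine[OF B(1)])
    show "finite I" using X by (simp add: I_def)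
    show "convex (A S) \<and> A S \<subseteq> {a + v |v. v \<in> span B}" if "S \<in> I" for S
    proof
      have cF: "convex (F z)" if "z \<in> insert x S \<union> Z" for z
        using F[of z] that x Z \<open>S \<in> I\<close> by (auto simp: I_def Conv_def)
      show "convex (A S)"
        unfolding convex_alt
      proof safe
        fix u v and t :: real assume "u \<in> A S" "v \<in> A S" and t: "0 \<le> t" "t \<le> 1"
        then obtain f g where fg: "lipsel c (insert x S \<union> Z) d F f" "P f" "u = f x"
          "lipsel c (insert x S \<union> Z) d F g" "P g" "v = g x"
          by (auto simp: A_def)
        show "(1 - t) *\<^sub>R u + t *\<^sub>R v \<in> A S"
          unfolding A_def mem_Collect_eq
          using lipsel_convex_comb[OF fg(1,4) cF t] P[OF fg(2,5) t] fg(3,6)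
          by (intro exI[of _ "\<lambda>z. (1 - t) *\<^sub>R f z + t *\<^sub>R g z"]) simp
      qed
      show "A S \<subseteq> {a + v |v. v \<in> span B}"
        using B(3) by (auto simp: A_def lipsel_def)
    qed
    show "(\<Inter>S\<in>J. A S) \<noteq> {}" if J: "J \<subseteq> I" "card J \<le> card B + 1" for J
    proof -
      have "card (\<Union>J) \<le> (\<Sum>S\<in>J. card S)" by (rule card_Union_le_sum_card)
      also have "\<dots> \<le> card J * n"
        using J(1) by (intro sum_bounded_above[where K = n, simplified]) (auto simp: I_def)
      also have "\<dots> \<le> (M + 1) * n"
        using J(2) B(2) by (intro mult_right_mono) auto
      finally have "card (insert x (\<Union>J)) \<le> (M + 1) * n + 1"
        using card_insert_le_m1[of "(M+1)*n+1" "\<Union>J" x] by simp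
      moreover have "insert x (\<Union>J) \<subseteq> X" using J(1) x by (auto simp: I_def)
      ultimately obtain f where f: "lipsel c (insert x (\<Union>J) \<union> Z) d F f" "P f"
        using sel by blast
      have "f x \<in> A S" if "S \<in> J" for S
        unfolding A_def using f lipsel_subset[OF f(1), of "insert x S \<union> Z"] that by blast
      then show ?thesis by blast
    qed
  qed
  then obtain y where y: "\<And>S. S \<in> I \<Longrightarrow> y \<in> A S" by blast
  show ?thesis
  proof (intro exI[of _ y] allI impI)
    fix S assume "S \<subseteq> X" "card S \<le> n"
    then have "y \<in> A S" using y by (simp add: I_def)
    then show "\<exists>f. lipsel c (insert x S \<union> Z) d F f \<and> P f \<and> f x = y"
      by (auto simp: A_def)
  qed
qed

text \<open>The basic convex sets of Fefferman and Shvartsman.\<close>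

definition Gam ::
  "('a \<Rightarrow> 'a \<Rightarrow> real) \<Rightarrow> ('a \<Rightarrow> 'b::real_normed_vector set) \<Rightarrow> 'a set \<Rightarrow> nat \<Rightarrow> 'a \<Rightarrow> 'b set" where
  "Gam d F X n x = {y. \<forall>S\<subseteq>X. card S \<le> n \<longrightarrow> (\<exists>f. lipsel 1 (insert x S) d F f \<and> f x = y)}"

lemma Gam_antimono: "n \<le> n' \<Longrightarrow> Gam d F X n' x \<subseteq> Gam d F X n x"
  unfolding Gam_def using order_trans by blast

lemma convex_Gam:
  assumes "\<And>x. x \<in> X \<Longrightarrow> convex (F x)" "x \<in> X"
  shows "convex (Gam d F X n x)"
  unfolding convex_alt
proof safe
  fix u v and t :: real
  assume uv: "u \<in> Gam d F X n x" "v \<in> Gam d F X n x" and t: "0 \<le> t" "t \<le> 1"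
  show "(1 - t) *\<^sub>R u + t *\<^sub>R v \<in> Gam d F X n x"
    unfolding Gam_def mem_Collect_eq
  proof (intro allI impI)
    fix S assume S: "S \<subseteq> X" "card S \<le> n"
    obtain f g where fg: "lipsel 1 (insert x S) d F f" "f x = u" "lipsel 1 (insert x S) d F g" "g x = v"
      using uv S unfolding Gam_def by blast
    have "lipsel 1 (insert x S) d F (\<lambda>z. (1 - t) *\<^sub>R f z + t *\<^sub>R g z)"
      using assms S by (intro lipsel_convex_comb fg t) auto
    then show "\<exists>f. lipsel 1 (insert x S) d F f \<and> f x = (1 - t) *\<^sub>R u + t *\<^sub>R v"
      using fg(2,4) by (intro exI[of _ "\<lambda>z. (1 - t) *\<^sub>R f z + t *\<^sub>R g z"]) simp
  qed
qed

lemma Gam_nonempty: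
  assumes "finite X" "\<And>x. x \<in> X \<Longrightarrow> F x \<in> Conv M" "x \<in> X"
    and "\<And>S. S \<subseteq> X \<Longrightarrow> card S \<le> (M + 1) * n + 1 \<Longrightarrow> \<exists>f. lipsel 1 S d F f"
  shows "Gam d F X n x \<noteq> {}"
proof -
  have "\<exists>y. \<forall>S\<subseteq>X. card S \<le> n \<longrightarrow> (\<exists>f. lipsel 1 (insert x S \<union> {}) d F f \<and> True \<and> f x = y)"
    by (rule helly_selection[OF assms(1,2)]) (use assms(3,4) in auto)
  then show ?thesis by (auto simp: Gam_def)
qed

text \<open>Helly's theorem at \<open>x'\<close>, with the value at \<open>x\<close> fixed to be
  \<open>y\<close>. One application lowers the level from \<open>(M + 1) * n + 1\<close> to
  \<open>n\<close>.\<close>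

lemma Gam_near:
  assumes "finite X" "\<And>x. x \<in> X \<Longrightarrow> F x \<in> Conv M" "x \<in> X" "x' \<in> X"
    and y: "y \<in> Gam d F X ((M + 1) * n + 1) x"
  shows "\<exists>y'\<in>Gam d F X n x'. norm (y - y') \<le> d x x'"
proof -
  have "\<exists>y'. \<forall>S\<subseteq>X. card S \<le> n \<longrightarrow> (\<exists>f. lipsel 1 (insert x' S \<union> {x}) d F f \<and> f x = y \<and> f x' = y')"
  proof (rule helly_selection[OF assms(1,2)])
    show "\<exists>f. lipsel 1 (S \<union> {x}) d F f \<and> f x = y" if "S \<subseteq> X" "card S \<le> (M + 1) * n + 1" for S
      using y that by (auto simp: Gam_def)
  qed (use assms in \<open>auto simp flip: scaleR_add_left\<close>)
  then obtain y' where y': "\<And>S. S \<subseteq> X \<Longrightarrow> card S \<le> n \<Longrightarrow>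
      \<exists>f. lipsel 1 (insert x' S \<union> {x}) d F f \<and> f x = y \<and> f x' = y'" by blast
  have "y' \<in> Gam d F X n x'"
    unfolding Gam_def using y' lipsel_subset by (smt (verit) mem_Collect_eq Un_upper1)
  \<comment> \<open>The node \<open>x\<close> belongs to the domain even for the empty set
    \<open>S\<close>, so the Lipschitz condition compares \<open>y\<close> with
    \<open>y'\<close>.\<close>
  moreover have "norm (y - y') \<le> d x x'"
    using y'[of "{}"] by (auto simp: lipsel_def)
  ultimately show ?thesis by blast
qed

lemma norm_add_diff_le: "norm (a + b - c) \<le> norm a + norm b + norm c"
  for a b c :: "'b::real_normed_vector"
  using norm_triangle_ineq4[of "a + b" c] norm_triangle_ineq[of a b] by linarith

subsection \<open>Reducing the dimension near a point\<close>

text \<open>The vector \<open>u - v\<close> lies in the direction space but not in the kernel of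
  \<open>\<phi>\<close>, so the kernel has smaller dimension there; it contains all differences of
  points of \<open>G\<close>.\<close>

lemma Conv_slice:
  fixes \<phi> :: "'b::real_vector \<Rightarrow> real"
  assumes S: "S \<in> Conv (Suc m)" and \<phi>: "linear \<phi>"
    and uv: "u \<in> S" "v \<in> S" "\<phi> u \<noteq> \<phi> v"
    and G: "G \<subseteq> S" "\<And>y. y \<in> G \<Longrightarrow> \<phi> y = t" "convex G" "G \<noteq> {}"
  shows "G \<in> Conv m"
proof -
  obtain a B where B: "finite B" "card B \<le> Suc m" "S \<subseteq> {a + v |v. v \<in> span B}"
    using S by (auto simp: Conv_def)
  have diff: "x - y \<in> span B" if xy: "x \<in> S" "y \<in> S" for x y
  proof -
    obtain v w where "v \<in> span B" "w \<in> span B" "x = a + v" "y = a + w"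
      using B(3) xy by blast
    then show ?thesis by (simp add: span_diff)
  qed
  define V where "V = span B \<inter> {y. \<phi> y = 0}"
  obtain A where A: "A \<subseteq> V" "independent A" "V \<subseteq> span A"
    using maximal_independent_subset[of V] by blast
  have "subspace {y. \<phi> y = 0}"
    using \<phi> by (simp add: linear_subspace_kernel)
  then have "span A \<subseteq> {y. \<phi> y = 0}"
    using A(1) unfolding V_def by (intro span_minimal) auto
  moreover have "\<phi> (u - v) \<noteq> 0"
    using uv(3) by (simp add: linear_diff[OF \<phi>])
  ultimately have "u - v \<notin> span A" by blast
  then have "independent (insert (u - v) A)"
    using A(2) by (rule independent_insertI)
  moreover have "insert (u - v) A \<subseteq> span B"
    using A(1) diff[OF uv(1,2)] by (auto simp: V_def)
  ultimately have "finite (insert (u - v) A) \<and> card (insert (u - v) A) \<le> card B"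
    by (rule independent_span_bound[OF B(1)])
  moreover have "u - v \<notin> A"
    using \<open>u - v \<notin> span A\<close> span_base by blast
  ultimately have finA: "finite A" "card A \<le> m" using B(2) by auto
  obtain g where g: "g \<in> G" using G(4) by blast
  have "G \<subseteq> {g + v |v. v \<in> span A}"
  proof
    fix y assume y: "y \<in> G"
    have "y - g \<in> V"
      unfolding V_def using diff[of y g] y g G(1,2) by (auto simp: linear_diff[OF \<phi>])
    then show "y \<in> {g + v |v. v \<in> span A}"
      using A(3) by (intro CollectI exI[of _ "y - g"]) auto
  qed
  then show ?thesis
    using finA A(2) G(3,4) unfolding Conv_def by blast
qed

text \<open>In a space of bounded functions, a coordinate at which \<open>v\<close> comes close to
  its supremum serves, up to a sign.\<close>

lemma almost_norming_functional:
  fixes v :: "'a::topological_space \<Rightarrow>\<^sub>C real"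
  obtains \<phi> :: "('a \<Rightarrow>\<^sub>C real) \<Rightarrow> real"
  where "linear \<phi>" "\<And>y. \<bar>\<phi> y\<bar> \<le> norm y" "norm v / 2 \<le> \<phi> v"
proof -
  obtain i where i: "norm v / 2 \<le> \<bar>apply_bcontfun v i\<bar>"
  proof (rule ccontr)
    assume *: "\<not> thesis"
    have "norm (apply_bcontfun v i) \<le> norm v / 2" for i
      using * that[of i] by fastforce
    then have "norm v \<le> norm v / 2" by (rule norm_bound)
    then have "v = 0" by simp
    then show False using * that by simp
  qed
  show ?thesis
  proof (rule that)
    let ?\<phi> = "\<lambda>y. sgn (apply_bcontfun v i) * apply_bcontfun y i"
    show "linear ?\<phi>" by (rule linearI) (simp_all add: algebra_simps)
    show "\<bar>?\<phi> y\<bar> \<le> norm y" for y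
      using norm_bounded[of y i] by (auto simp: abs_mult sgn_if)
    show "norm v / 2 \<le> ?\<phi> v"
      using i by (simp add: sgn_mult_self_eq mult.commute flip: abs_sgn)
  qed
qed

text \<open>Up to division by \<open>D\<close>, the difference is
  \<open>(b - b') - (b' / D') * (D - D')\<close>. The factor \<open>b' / D'\<close> is at most 1, so
  the two errors add up to \<open>e + 2 * e\<close>.\<close>

lemma abs_quotient_diff_le:
  fixes b b' D D' :: real
  assumes "0 < c" "c \<le> D" "c \<le> D'" "0 \<le> b'" "b' \<le> D'" "\<bar>b - b'\<bar> \<le> e" "\<bar>D - D'\<bar> \<le> 2 * e"
  shows "\<bar>b / D - b' / D'\<bar> \<le> 3 * e / c"
proof -
  define q where "q = (b' / D') * (D - D')"
  have "\<bar>q\<bar> \<le> 1 * (2 * e)"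
    unfolding q_def abs_mult using assms by (intro mult_mono) auto
  then have "\<bar>(b - b') - q\<bar> \<le> 3 * e"
    using assms(6) by linarith
  moreover have "b / D - b' / D' = ((b - b') - q) / D"
    using assms unfolding q_def by (simp add: field_simps)
  ultimately show ?thesis
    using assms by (auto simp: abs_divide intro!: frac_le)
qed

text \<open>The reduction of the dimension. The factor 10 is the Lipschitz constant of the
  interpolated selections. The bound \<open>2 * r\<close> is built into the slices, so the selection
  supplied by the induction hypothesis inherits it.\<close>

lemma local_selection:
  fixes F :: "'a \<Rightarrow> (nat \<Rightarrow>\<^sub>C real) set"
  assumes T: "tree_metric d X" and F: "\<And>x. x \<in> X \<Longrightarrow> F x \<in> Conv (Suc m)"
    and IH: "\<And>X d (F :: 'a \<Rightarrow> (nat \<Rightarrow>\<^sub>C real) set). tree_metric d X \<Longrightarrow> (\<And>x. x \<in> X \<Longrightarrow> F x \<in> Conv m) \<Longrightarrow>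
      (\<And>S. S \<subseteq> X \<Longrightarrow> card S \<le> k \<Longrightarrow> \<exists>f. lipsel 1 S d F f) \<Longrightarrow> \<exists>f. lipsel C X d F f"
    and k: "k \<ge> 1" and x: "x \<in> X" and u: "u \<in> Gam d F X k x" and p: "p \<in> Gam d F X k x"
    and r: "norm (p - u) = r" "r > 0"
  shows "\<exists>f. lipsel (10 * C) {z \<in> X. d x z \<le> r / 16} d F f \<and>
    (\<forall>z\<in>X. d x z \<le> r / 16 \<longrightarrow> norm (f z - u) \<le> 2 * r)"
proof -
  obtain \<phi> :: "(nat \<Rightarrow>\<^sub>C real) \<Rightarrow> real"
    where \<phi>: "linear \<phi>" "\<And>y. \<bar>\<phi> y\<bar> \<le> norm y" "norm (p - u) / 2 \<le> \<phi> (p - u)"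
    using almost_norming_functional[of "p - u"] by blast
  note \<phi>_diff = linear_diff[OF \<phi>(1)]
  \<comment> \<open>Since \<open>\<phi> (p - u)\<close> is at least \<open>r / 2\<close>, this level
    has distance at least \<open>r / 4\<close> from \<open>\<phi> u\<close> and from
    \<open>\<phi> p\<close>.\<close>
  define t where "t = (\<phi> p + \<phi> u) / 2"
  define B where "B = {z \<in> X. d x z \<le> r / 16}"
  define F' where "F' z = {y \<in> F z. \<phi> y = t \<and> norm (y - u) \<le> 2 * r}" for z
  \<comment> \<open>The second conjunct says that \<open>\<phi>\<close> is not constant on
    \<open>F z\<close>, which is what makes the slice lose a dimension.\<close>
  have key: "\<exists>f. lipsel 10 S d F' f \<and> (\<forall>z\<in>S. \<exists>a\<in>F z. \<exists>b\<in>F z. \<phi> a \<noteq> \<phi> b)"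
    if S: "S \<subseteq> B" "card S \<le> k" for S
  proof -
    have SX: "S \<subseteq> X" using S by (auto simp: B_def)
    obtain f where f: "lipsel 1 (insert x S) d F f" "f x = u"
      using u SX S(2) by (auto simp: Gam_def)
    obtain g where g: "lipsel 1 (insert x S) d F g" "g x = p"
      using p SX S(2) by (auto simp: Gam_def)
    define a where "a z = t - \<phi> (f z)" for z
    define D where "D z = \<phi> (g z) - \<phi> (f z)" for z
    \<comment> \<open>With this weight, the blend of \<open>f z\<close> and \<open>g z\<close> has
      exactly the level \<open>t\<close>.\<close>
    define \<theta> where "\<theta> z = a z / D z" for z
    have near: "norm (f z - u) \<le> r / 16" "norm (g z - p) \<le> r / 16" if "z \<in> S" for z
    proof -
      have "d z x \<le> r / 16"
        using that S(1) tree_metric_sym[OF T x, of z] by (auto simp: B_def)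
      then show "norm (f z - u) \<le> r / 16" "norm (g z - p) \<le> r / 16"
        using lipselD(2)[OF f(1), of z x] lipselD(2)[OF g(1), of z x] that f(2) g(2) by auto
    qed
    \<comment> \<open>On the ball \<open>f\<close> and \<open>g\<close> have moved by at most
      \<open>r / 16\<close>, which leaves \<open>r / 4 - r / 16 = 3 * r / 16\<close> on either side
      of the level. Hence \<open>D z\<close> is at least \<open>3 * r / 8\<close>.\<close>
    have bnd: "3 * r / 16 \<le> a z" "a z + 3 * r / 16 \<le> D z" if "z \<in> S" for z
      using \<phi>(2)[of "f z - u"] \<phi>(2)[of "g z - p"] near[OF that] \<phi>(3) r(1)
      unfolding a_def D_def t_def \<phi>_diff by (simp_all add: abs_le_iff field_simps)
    have \<theta>: "0 \<le> \<theta> z" "\<theta> z \<le> 1" if "z \<in> S" for z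
      using bnd[OF that] r(2) by (auto simp: \<theta>_def)
    define h where "h z = (1 - \<theta> z) *\<^sub>R f z + \<theta> z *\<^sub>R g z" for z
    have "lipsel 10 S d F' h"
    proof (rule lipselI)
      fix z assume z: "z \<in> S"
      have "convex (F z)" using F[of z] SX z by (auto simp: Conv_def)
      then have "h z \<in> F z"
        using \<theta>[OF z] lipselD(1)[OF f(1), of z] lipselD(1)[OF g(1), of z] z
        unfolding h_def by (simp add: convex_alt)
      moreover have "\<phi> (h z) = \<phi> (f z) + \<theta> z * D z"
        unfolding h_def D_def linear_add[OF \<phi>(1)] linear_cmul[OF \<phi>(1)] by (simp add: algebra_simps)
      then have "\<phi> (h z) = t"
        using bnd[OF z] r(2) by (simp add: \<theta>_def a_def)
      moreover have "norm (h z - u) \<le> 2 * r"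
      proof -
        have "norm (g z - u) \<le> 2 * r"
          using norm_triangle_ineq[of "g z - p" "p - u"] near(2)[OF z] r by simp
        moreover have "norm (f z - u) \<le> 2 * r" using near(1)[OF z] r by linarith
        ultimately have "f z \<in> cball u (2 * r)" "g z \<in> cball u (2 * r)"
          by (simp_all add: dist_norm norm_minus_commute)
        then have "h z \<in> cball u (2 * r)"
          using convex_cball[of u "2 * r"] \<theta>[OF z] unfolding h_def by (simp add: convex_alt)
        then show ?thesis by (simp add: dist_norm norm_minus_commute)
      qed
      ultimately show "h z \<in> F' z" by (simp add: F'_def)
      fix w assume w: "w \<in> S"
      let ?e = "d z w"
      have e: "norm (f z - f w) \<le> ?e" "norm (g z - g w) \<le> ?e"
        using lipselD(2)[OF f(1), of z w] lipselD(2)[OF g(1), of z w] z w by auto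
      have "\<bar>\<theta> z - \<theta> w\<bar> \<le> 3 * ?e / (3 * r / 8)"
        unfolding \<theta>_def
      proof (rule abs_quotient_diff_le)
        show "\<bar>a z - a w\<bar> \<le> ?e" "\<bar>D z - D w\<bar> \<le> 2 * ?e"
          using \<phi>(2)[of "f z - f w"] \<phi>(2)[of "g z - g w"] e unfolding a_def D_def \<phi>_diff
          by linarith+
      qed (use bnd[OF z] bnd[OF w] r(2) in linarith)+
      moreover have "norm (f z - g z) \<le> 9 * r / 8"
      proof -
        have "f z - g z = (f z - u) + (u - p) - (g z - p)" by simp
        then have "norm (f z - g z) \<le> norm (f z - u) + norm (u - p) + norm (g z - p)"
          using norm_add_diff_le by metis
        then show ?thesis using near[OF z] r(1) by (simp add: norm_minus_commute)
      qed
      then have "norm (h z - h w) \<le> ?e + \<bar>\<theta> z - \<theta> w\<bar> * (9 * r / 8)"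
        unfolding h_def by (intro norm_blend_diff_le e \<theta>[OF w])
      moreover have "0 \<le> 9 * r / 8" using r(2) by simp
      \<comment> \<open>The weight contributes \<open>8 / r * (9 * r / 8) = 9\<close>, for a total
        constant of \<open>1 + 9 = 10\<close>.\<close>
      ultimately have "norm (h z - h w) \<le> ?e + 3 * ?e / (3 * r / 8) * (9 * r / 8)"
        by (meson add_left_mono mult_right_mono order_trans)
      then show "norm (h z - h w) \<le> 10 * ?e"
        using r(2) by (simp add: field_simps)
    qed
    moreover have "\<exists>a\<in>F z. \<exists>b\<in>F z. \<phi> a \<noteq> \<phi> b" if z: "z \<in> S" for z
    proof (intro bexI)
      show "\<phi> (g z) \<noteq> \<phi> (f z)" using bnd[OF z] r(2) by (auto simp: D_def)
      show "g z \<in> F z" "f z \<in> F z"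
        using lipselD(1)[OF f(1), of z] lipselD(1)[OF g(1), of z] z by auto
    qed
    ultimately show ?thesis by blast
  qed
  \<comment> \<open>The metric is stretched by 10 to turn the Lipschitz constant 10 into the
    constant 1 of the induction hypothesis.\<close>
  have "\<exists>f. lipsel C B (\<lambda>x y. 10 * d x y) F' f"
  proof (rule IH)
    show "tree_metric (\<lambda>x y. 10 * d x y) B"
      unfolding B_def using r(2) by (intro tree_metric_scale tree_metric_ball T x) auto
    show "F' z \<in> Conv m" if z: "z \<in> B" for z
    proof -
      obtain f a b where f: "lipsel 10 {z} d F' f" and ab: "a \<in> F z" "b \<in> F z" "\<phi> a \<noteq> \<phi> b"
        using key[of "{z}"] z k by auto
      have zX: "z \<in> X" using z by (simp add: B_def)
      have eq: "F' z = F z \<inter> {y. \<phi> y = t} \<inter> cball u (2 * r)"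
        by (auto simp: F'_def dist_norm norm_minus_commute)
      show ?thesis
      proof (rule Conv_slice[OF F[OF zX] \<phi>(1) ab])
        have "convex (F z)" using F[OF zX] by (simp add: Conv_def)
        moreover have "convex {y. \<phi> y = t}"
          unfolding convex_alt mem_Collect_eq linear_add[OF \<phi>(1)] linear_cmul[OF \<phi>(1)]
          by (simp add: algebra_simps)
        ultimately show "convex (F' z)"
          unfolding eq by (intro convex_Int convex_cball)
        show "F' z \<noteq> {}" using lipselD(1)[OF f] by blast
      qed (auto simp: F'_def)
    qed
    show "\<exists>f. lipsel 1 S (\<lambda>x y. 10 * d x y) F' f" if "S \<subseteq> B" "card S \<le> k" for S
      using key[OF that] by (auto simp: lipsel_def)
  qed
  then obtain f where f: "lipsel C B (\<lambda>x y. 10 * d x y) F' f" by blast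
  show ?thesis
    unfolding B_def[symmetric]
  proof (intro exI conjI ballI impI)
    show "lipsel (10 * C) B d F f"
      using f by (auto simp: lipsel_def F'_def algebra_simps)
    show "norm (f z - u) \<le> 2 * r" if "z \<in> X" "d x z \<le> r / 16" for z
      using f that by (auto simp: lipsel_def F'_def B_def)
  qed
qed

subsection \<open>Gluing local selections along a tree\<close>

text \<open>The selection is built by walking down the tree. The state \<open>(u, w)\<close> at a node \<open>z\<close> says that
  the value at \<open>z\<close> is a convex combination of \<open>f w z\<close> and \<open>f u z\<close>, whose weight shifts
  from \<open>f w\<close> to \<open>f u\<close> as \<open>z\<close> moves away from \<open>u\<close>. Once \<open>f u\<close> has full weight, the current node
  becomes the new centre, without changing the value.\<close>

lemma glue_local_selections:
  fixes F :: "'a \<Rightarrow> 'b::real_normed_vector set"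
  assumes T: "tree_metric d X" and F: "\<And>x. x \<in> X \<Longrightarrow> convex (F x)"
    and r0: "\<And>x. x \<in> X \<Longrightarrow> 0 \<le> r x"
    and r: "\<And>x y. x \<in> X \<Longrightarrow> y \<in> X \<Longrightarrow> r x \<le> r y + d x y"
    and \<eta>: "\<And>x y. x \<in> X \<Longrightarrow> y \<in> X \<Longrightarrow> norm (\<eta> x - \<eta> y) \<le> 2 * r x + d x y"
    and f: "\<And>x. x \<in> X \<Longrightarrow> lipsel C {z \<in> X. d x z \<le> r x / 48} d F (f x)"
    and f\<eta>: "\<And>x z. x \<in> X \<Longrightarrow> z \<in> X \<Longrightarrow> d x z \<le> r x / 48 \<Longrightarrow> norm (f x z - \<eta> x) \<le> r x"
    and C: "C \<ge> 0"
  shows "\<exists>g. lipsel (C + 5000) X d F g"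
proof -
  \<comment> \<open>The radii are well below \<open>r / 48\<close>, so that \<open>z\<close> lies in
    the domains of both \<open>f u\<close> and \<open>f w\<close>.\<close>
  define I where "I z s \<longleftrightarrow> (case s of (u, w) \<Rightarrow>
    u \<in> X \<and> w \<in> X \<and> d u z \<le> r u / 160 \<and> d w u \<le> r w / 160)" for z s
  \<comment> \<open>The weight grows from 0 at the centre to 1 at distance \<open>r u / 480\<close>.
    For \<open>r u = 0\<close> the division yields weight 0, and then \<open>u\<close> is the only
    node that can have a state \<open>(u, w)\<close>.\<close>
  define \<theta> where "\<theta> u z = min 1 (480 * d u z / r u)" for u z
  define v where "v z s = (case s of (u, w) \<Rightarrow> (1 - \<theta> u z) *\<^sub>R f w z + \<theta> u z *\<^sub>R f u z)" for z s
  note refl = tree_metric_refl[OF T] and sym = tree_metric_sym[OF T]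
    and nn = tree_metric_nonneg[OF T] and tri = tree_metric_triangle[OF T]
  have \<theta>01: "0 \<le> \<theta> u z" "\<theta> u z \<le> 1" if "u \<in> X" "z \<in> X" for u z
    using nn[OF that] r0[OF that(1)] by (auto simp: \<theta>_def)
  have inv: "u \<in> X" "w \<in> X" "d u z \<le> r u / 48" "d w z \<le> r w / 48" "r w \<le> 2 * r u" "d w z \<le> r u / 10"
    if "I z (u, w)" "z \<in> X" for z u w
  proof -
    show uw: "u \<in> X" "w \<in> X" using that by (auto simp: I_def)
    note * = tri[OF uw(2,1) that(2)] r[OF uw(1,2)] r[OF uw(2,1)] sym[OF uw] r0[OF uw(1)] r0[OF uw(2)] that(1)
    show "d u z \<le> r u / 48" "d w z \<le> r w / 48" "r w \<le> 2 * r u" "d w z \<le> r u / 10"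
      using * by (auto simp: I_def)
  qed
  have inF: "v z s \<in> F z" if "I z s" "z \<in> X" for z s
  proof -
    obtain u w where s: "s = (u, w)" by force
    note i = inv[OF that[unfolded s]]
    have "f w z \<in> F z" "f u z \<in> F z"
      using lipselD(1)[OF f[OF i(1)], of z] lipselD(1)[OF f[OF i(2)], of z] i that by auto
    then show ?thesis
      using F[OF that(2)] \<theta>01[OF i(1) that(2)] by (simp add: v_def s convex_alt)
  qed
  have keep: "norm (v p s - v z s) \<le> (C + 5000) * d p z"
    if Ip: "I p s" and Iz: "I z s" and pz: "p \<in> X" "z \<in> X" for p z s
  proof -
    obtain u w where s: "s = (u, w)" by force
    note ip = inv[OF Ip[unfolded s] pz(1)] and iz = inv[OF Iz[unfolded s] pz(2)]
    have e: "norm (f w p - f w z) \<le> C * d p z" "norm (f u p - f u z) \<le> C * d p z"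
      using lipselD(2)[OF f[OF ip(1)], of p z] lipselD(2)[OF f[OF ip(2)], of p z] ip iz pz by auto
    show ?thesis
    proof (cases "r u = 0")
      case True
      then have "d u p \<le> 0" "d u z \<le> 0" using ip iz by auto
      then have "p = z"
        using tree_metric_pos[OF T] ip(1) pz by (metis not_less)
      then show ?thesis using nn[OF pz] C by simp
    next
      case False
      then have ru: "r u > 0" using r0[OF ip(1)] by simp
      have min1: "\<bar>min 1 a - min 1 b\<bar> \<le> \<bar>a - b\<bar>" for a b :: real by (simp add: min_def)
      have "\<bar>480 * d u p / r u - 480 * d u z / r u\<bar> \<le> 480 * d p z / r u"
      proof -
        have "\<bar>d u p - d u z\<bar> \<le> d p z"
          using tri[OF ip(1) pz] tri[OF ip(1) pz(2,1)] sym[OF pz] by linarith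
        moreover have eq: "480 * d u p / r u - 480 * d u z / r u = 480 / r u * (d u p - d u z)"
          using ru by (simp add: field_simps)
        ultimately show ?thesis
          unfolding eq abs_mult
          using ru mult_left_mono[of "\<bar>d u p - d u z\<bar>" "d p z" "480 / r u"] by simp
      qed
      then have \<theta>d: "\<bar>\<theta> u p - \<theta> u z\<bar> \<le> 480 * d p z / r u"
        unfolding \<theta>_def by (rule order_trans[OF min1])
      \<comment> \<open>The values are compared through \<open>\<eta> w\<close> and
        \<open>\<eta> u\<close>, using that \<open>r w\<close> is at most
        \<open>2 * r u\<close>.\<close>
      have "norm (f w p - f u p) \<le> 7 * r u"
      proof -
        have "f w p - f u p = (f w p - \<eta> w) + (\<eta> w - \<eta> u) - (f u p - \<eta> u)" by simp
        then have "norm (f w p - f u p) \<le> norm (f w p - \<eta> w) + norm (\<eta> w - \<eta> u) + norm (f u p - \<eta> u)"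
          using norm_add_diff_le by metis
        moreover have "norm (\<eta> w - \<eta> u) \<le> 2 * r u + d u w"
          using \<eta>[OF ip(1,2)] by (simp add: norm_minus_commute)
        moreover have "d u w \<le> r u"
          using Ip ip(5) sym[OF ip(1,2)] ru by (auto simp: I_def s)
        ultimately show ?thesis
          using f\<eta>[OF ip(1) pz(1) ip(3)] f\<eta>[OF ip(2) pz(1) ip(4)] ip(5) ru by linarith
      qed
      then have "norm (v p s - v z s) \<le> C * d p z + \<bar>\<theta> u p - \<theta> u z\<bar> * (7 * r u)"
        unfolding v_def s prod.case by (intro norm_blend_diff_le e \<theta>01 ip(1) pz(2))
      \<comment> \<open>The shift of the weight contributes \<open>480 * 7 = 3360\<close>, which is
        below 5000.\<close>
      also have "\<dots> \<le> C * d p z + 480 * d p z / r u * (7 * r u)"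
        using \<theta>d ru by (intro add_left_mono mult_right_mono) auto
      also have "\<dots> \<le> (C + 5000) * d p z"
        using ru nn[OF pz] by (simp add: field_simps)
      finally show ?thesis .
    qed
  qed
  have step: "\<exists>s'. I z s' \<and> norm (v p s - v z s') \<le> (C + 5000) * d p z"
    if pz: "p \<in> X" "z \<in> X" and Ip: "I p s" for p z s
  proof -
    obtain u w where s: "s = (u, w)" by force
    note ip = inv[OF Ip[unfolded s] pz(1)]
    have ru: "r u \<le> 2 * r p" "r p \<le> 2 * r u"
      using r[OF ip(1) pz(1)] r[OF pz(1) ip(1)] sym[OF pz(1) ip(1)] ip(3) r0[OF ip(1)]
      by linarith+
    show ?thesis
    proof (cases "r p / 480 \<le> d p z")
      \<comment> \<open>A step that is long compared with \<open>r p\<close>: the construction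
        restarts at \<open>z\<close> with \<open>(z, z)\<close>, and the step itself pays for the
        jump of the value.\<close>
      case True
      have Iz: "I z (z, z)" using refl[OF pz(2)] r0[OF pz(2)] pz(2) by (simp add: I_def)
      have vz: "v z (z, z) = f z z" by (simp add: v_def flip: scaleR_add_left)
      have b: "norm (f a p - \<eta> p) \<le> 7 * r p"
        if "a \<in> X" "d a p \<le> r a / 48" "r a \<le> 4 * r p" for a
      proof -
        have "norm ((f a p - \<eta> a) - (\<eta> p - \<eta> a)) \<le> r a + (2 * r p + d a p)"
          using norm_triangle_ineq4[of "f a p - \<eta> a" "\<eta> p - \<eta> a"] f\<eta>[OF that(1) pz(1) that(2)]
            \<eta>[OF pz(1) that(1)] sym[OF pz(1) that(1)] by linarith
        then show ?thesis using that r0[OF pz(1)] by simp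
      qed
      have "norm (f w p - \<eta> p) \<le> 7 * r p" "norm (f u p - \<eta> p) \<le> 7 * r p"
        using b[of w] b[of u] ip ru r0[OF pz(1)] by auto
      then have "f w p \<in> cball (\<eta> p) (7 * r p)" "f u p \<in> cball (\<eta> p) (7 * r p)"
        by (simp_all add: dist_norm norm_minus_commute)
      then have "v p s \<in> cball (\<eta> p) (7 * r p)"
        using convex_cball[of "\<eta> p" "7 * r p"] \<theta>01[OF ip(1) pz(1)]
        by (simp add: v_def s convex_alt del: mem_cball)
      then have vp: "norm (v p s - \<eta> p) \<le> 7 * r p" by (simp add: dist_norm norm_minus_commute)
      have "norm (f z z - \<eta> z) \<le> r z"
        using refl[OF pz(2)] r0[OF pz(2)] pz(2) by (intro f\<eta>) auto
      moreover have "v p s - f z z = (v p s - \<eta> p) + (\<eta> p - \<eta> z) - (f z z - \<eta> z)" by simp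
      then have "norm (v p s - f z z) \<le> norm (v p s - \<eta> p) + norm (\<eta> p - \<eta> z) + norm (f z z - \<eta> z)"
        using norm_add_diff_le by metis
      ultimately have "norm (v p s - f z z) \<le> 10 * r p + 2 * d p z"
        using vp \<eta>[OF pz] r[OF pz(2,1)] sym[OF pz] by linarith
      \<comment> \<open>Here \<open>r p\<close> is at most \<open>480 * d p z\<close>, which gives
        \<open>4800 + 2\<close> in total.\<close>
      also have "\<dots> \<le> 5000 * d p z" using True nn[OF pz] by linarith
      also have "\<dots> \<le> (C + 5000) * d p z"
        using C nn[OF pz] by (simp add: distrib_right)
      finally show ?thesis using Iz vz by metis
    next
      case near: False
      show ?thesis
      proof (cases "d u p < r u / 480")
        \<comment> \<open>The state is kept. The step is shorter than \<open>r p / 480\<close>,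
          hence than \<open>2 * r u / 480\<close>, so \<open>z\<close> stays within
          \<open>3 * r u / 480 = r u / 160\<close> of \<open>u\<close>.\<close>
        case True
        then have "I z s"
          using Ip near ru tri[OF ip(1) pz] by (auto simp: I_def s)
        then show ?thesis using keep[OF Ip _ pz] by blast
      next
        \<comment> \<open>The shift to \<open>f u\<close> is complete at \<open>p\<close>, and
          \<open>(p, u)\<close> has weight 0 at its own centre. Both states therefore give the value
          \<open>f u p\<close>, and the walk goes on from \<open>p\<close> as the new
          centre.\<close>
        case False
        have rp: "r p > 0" using near nn[OF pz] by linarith
        then have "r u > 0" using ru by linarith
        then have "\<theta> u p = 1" using False by (simp add: \<theta>_def min_def field_simps)
        moreover have "\<theta> p p = 0" using refl[OF pz(1)] by (simp add: \<theta>_def)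
        ultimately have eq: "v p s = v p (p, u)" by (simp add: v_def s)
        have "I p (p, u)" "I z (p, u)"
          using Ip near rp refl[OF pz(1)] pz(1) by (auto simp: I_def s)
        then show ?thesis
          unfolding eq using keep[OF _ _ pz] by blast
      qed
    qed
  qed
  have "\<exists>\<sigma>. \<forall>x\<in>X. I x (\<sigma> x) \<and> (\<forall>y\<in>X. norm (v x (\<sigma> x) - v y (\<sigma> y)) \<le> (C + 5000) * d x y)"
  proof (rule tree_greedy[OF T])
    show "\<exists>s. I x s" if "x \<in> X" for x
      using refl[OF that] r0[OF that] that by (intro exI[of _ "(x, x)"]) (simp add: I_def)
  qed (use step C in auto)
  then obtain \<sigma> where "\<forall>x\<in>X. I x (\<sigma> x) \<and>
      (\<forall>y\<in>X. norm (v x (\<sigma> x) - v y (\<sigma> y)) \<le> (C + 5000) * d x y)" by blast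
  then have "lipsel (C + 5000) X d F (\<lambda>x. v x (\<sigma> x))"
    using inF unfolding lipsel_def by blast
  then show ?thesis by blast
qed

subsection \<open>Induction on the dimension\<close>

lemma lipsel_mono:
  assumes "lipsel c S d F f" "c \<le> c'" "\<And>x y. x \<in> S \<Longrightarrow> y \<in> S \<Longrightarrow> 0 \<le> d x y"
  shows "lipsel c' S d F f"
proof (rule lipselI)
  show "f x \<in> F x" if "x \<in> S" for x
    using lipselD(1)[OF assms(1) that] .
  show "norm (f x - f y) \<le> c' * d x y" if "x \<in> S" "y \<in> S" for x y
    using lipselD(2)[OF assms(1) that] mult_right_mono[OF assms(2) assms(3)[OF that]] by linarith
qed

lemma convex_ex_norm_diff_eq:
  fixes S :: "'b::real_normed_vector set"
  assumes "convex S" "u \<in> S" "q \<in> S" "s \<le> norm (q - u)" "0 < s"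
  shows "\<exists>p\<in>S. norm (p - u) = s"
proof
  let ?t = "s / norm (q - u)"
  have "0 < norm (q - u)" using assms by linarith
  then show "norm (((1 - ?t) *\<^sub>R u + ?t *\<^sub>R q) - u) = s"
    using assms(5) by (simp add: algebra_simps flip: scaleR_diff_right)
  show "(1 - ?t) *\<^sub>R u + ?t *\<^sub>R q \<in> S"
    using assms by (intro convexD_alt) (auto simp: divide_le_eq_1)
qed

text \<open>The number of nodes in the hypothesis accounts for two uses of Helly's theorem: one
  makes the sets of level \<open>(Suc m + 1) * k + 1\<close> nonempty, the other descends from them
  to nearby points of level \<open>k\<close>.\<close>

lemma tree_selection_step:
  fixes F :: "'a \<Rightarrow> (nat \<Rightarrow>\<^sub>C real) set"
  assumes T: "tree_metric d X" and F: "\<And>x. x \<in> X \<Longrightarrow> F x \<in> Conv (Suc m)"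
    and IH: "\<And>X d (F :: 'a \<Rightarrow> (nat \<Rightarrow>\<^sub>C real) set). tree_metric d X \<Longrightarrow> (\<And>x. x \<in> X \<Longrightarrow> F x \<in> Conv m) \<Longrightarrow>
      (\<And>S. S \<subseteq> X \<Longrightarrow> card S \<le> k \<Longrightarrow> \<exists>f. lipsel 1 S d F f) \<Longrightarrow> \<exists>f. lipsel C X d F f"
    and k: "k \<ge> 1" and C: "C \<ge> 0"
    and sel: "\<And>S. S \<subseteq> X \<Longrightarrow> card S \<le> (Suc m + 1) * ((Suc m + 1) * k + 1) + 1 \<Longrightarrow> \<exists>f. lipsel 1 S d F f"
  shows "\<exists>f. lipsel (10 * C + 5000) X d F f"
proof -
  note fin = tree_metric_finite[OF T] and refl = tree_metric_refl[OF T]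
    and sym = tree_metric_sym[OF T] and nn = tree_metric_nonneg[OF T]
    and tri = tree_metric_triangle[OF T]
  have cF: "convex (F x)" if "x \<in> X" for x using F[OF that] by (simp add: Conv_def)
  define G where "G x = Gam d F X k x" for x
  have cG: "convex (G x)" if "x \<in> X" for x
    unfolding G_def using cF that by (rule convex_Gam)
  have "\<exists>y. y \<in> Gam d F X ((Suc m + 1) * k + 1) x" if "x \<in> X" for x
  proof -
    have "Gam d F X ((Suc m + 1) * k + 1) x \<noteq> {}"
      by (rule Gam_nonempty[OF fin F that sel])
    then show ?thesis by blast
  qed
  \<comment> \<open>The centres are taken from the higher level, so that every \<open>G x'\<close>
    contains a point within \<open>d x x'\<close> of \<open>\<eta> x\<close>.\<close>
  then obtain \<eta> where \<eta>: "\<And>x. x \<in> X \<Longrightarrow> \<eta> x \<in> Gam d F X ((Suc m + 1) * k + 1) x"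
    by metis
  have \<eta>G: "\<eta> x \<in> G x" if "x \<in> X" for x
    using \<eta>[OF that] Gam_antimono[of k "(Suc m + 1) * k + 1" d F X x] by (auto simp: G_def)
  have near: "\<exists>y\<in>G x'. norm (\<eta> x - y) \<le> d x x'" if "x \<in> X" "x' \<in> X" for x x'
    unfolding G_def by (rule Gam_near[OF fin F that \<eta>[OF that(1)]])
  have loc: "\<exists>f. lipsel (10 * C) {z \<in> X. d x z \<le> s / 16} d F f \<and>
      (\<forall>z\<in>X. d x z \<le> s / 16 \<longrightarrow> norm (f z - \<eta> x) \<le> 2 * s)"
    if x: "x \<in> X" and s: "0 < s" and q: "q \<in> G x" "s \<le> norm (q - \<eta> x)" for x s q
  proof -
    obtain p where p: "p \<in> G x" "norm (p - \<eta> x) = s"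
      using convex_ex_norm_diff_eq[OF cG[OF x] \<eta>G[OF x] q s] by blast
    show ?thesis
      by (rule local_selection[OF T F IH k x \<eta>G[OF x, unfolded G_def] p(1)[unfolded G_def] p(2) s])
  qed
  show ?thesis
  proof (cases "\<exists>x\<in>X. bounded (G x)")
    \<comment> \<open>If every \<open>G x\<close> is unbounded, one local selection on a ball large
      enough to contain all of \<open>X\<close> does everything.\<close>
    case False
    obtain x where x: "x \<in> X" using tree_metric_nonempty[OF T] by blast
    define s where "s = 16 * (Max (d x ` X) + 1)"
    have le: "d x z \<le> s / 16" if "z \<in> X" for z
    proof -
      have "d x z \<le> Max (d x ` X)" using fin that by simp
      then show ?thesis by (simp add: s_def)
    qed
    have "d x x \<le> Max (d x ` X)" using fin x by simp
    then have s: "0 < s" using refl[OF x] by (simp add: s_def)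
    have "\<exists>q\<in>G x. s \<le> norm (q - \<eta> x)"
    proof (rule ccontr)
      assume "\<not> ?thesis"
      then have "G x \<subseteq> cball (\<eta> x) s" by (force simp: dist_norm norm_minus_commute)
      then show False using False x bounded_cball bounded_subset by blast
    qed
    then obtain f where "lipsel (10 * C) {z \<in> X. d x z \<le> s / 16} d F f"
      using loc[OF x s] by blast
    moreover have "{z \<in> X. d x z \<le> s / 16} = X" using le by auto
    ultimately show ?thesis using lipsel_mono[of "10 * C" X d F f "10 * C + 5000"] nn by auto
  next
    case True
    \<comment> \<open>The diameter measures the size of a set only if the set is bounded, so the
      minimum below ranges over these nodes.\<close>
    define X\<^sub>b where "X\<^sub>b = {x \<in> X. bounded (G x)}"
    have Xb: "finite X\<^sub>b" "X\<^sub>b \<noteq> {}" "X\<^sub>b \<subseteq> X" using True fin by (auto simp: X\<^sub>b_def)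
    have bd: "bounded (G x)" if "x \<in> X\<^sub>b" for x using that by (simp add: X\<^sub>b_def)
    define r where "r x = Min ((\<lambda>x'. diameter (G x') + d x x') ` X\<^sub>b)" for x
    have r_le: "r x \<le> diameter (G x') + d x x'" if "x' \<in> X\<^sub>b" for x x'
      unfolding r_def using Xb that by (intro Min_le) auto
    have r_att: "\<exists>x'\<in>X\<^sub>b. r x = diameter (G x') + d x x'" for x
    proof -
      have "r x \<in> (\<lambda>x'. diameter (G x') + d x x') ` X\<^sub>b"
        unfolding r_def using Xb by (intro Min_in) auto
      then show ?thesis by blast
    qed
    have r0: "0 \<le> r x" if "x \<in> X" for x
    proof -
      obtain x' where x': "x' \<in> X\<^sub>b" "r x = diameter (G x') + d x x'" using r_att by blast
      then show ?thesis using nn[OF that, of x'] Xb(3) diameter_ge_0[OF bd[OF x'(1)]] by auto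
    qed
    have r_lip: "r x \<le> r y + d x y" if "x \<in> X" "y \<in> X" for x y
    proof -
      obtain y' where "y' \<in> X\<^sub>b" "r y = diameter (G y') + d y y'" using r_att by blast
      then show ?thesis using r_le[of y' x] tri[OF that, of y'] Xb(3) by auto
    qed
    \<comment> \<open>Both \<open>\<eta> x\<close> and \<open>\<eta> y\<close> are close to the set
      \<open>G x'\<close> at a node \<open>x'\<close> where the minimum \<open>r x\<close> is
      attained, and that set has small diameter.\<close>
    have \<eta>_near: "norm (\<eta> x - \<eta> y) \<le> 2 * r x + d x y" if xy: "x \<in> X" "y \<in> X" for x y
    proof -
      obtain x' where x': "x' \<in> X\<^sub>b" "r x = diameter (G x') + d x x'" using r_att by blast
      then have x'X: "x' \<in> X" using Xb by blast
      obtain a where a: "a \<in> G x'" "norm (\<eta> x - a) \<le> d x x'" using near[OF xy(1) x'X] by blast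
      obtain b where b: "b \<in> G x'" "norm (\<eta> y - b) \<le> d y x'" using near[OF xy(2) x'X] by blast
      have "norm (a - b) \<le> diameter (G x')"
        using diameter_bounded_bound[OF bd[OF x'(1)] a(1) b(1)] by (simp add: dist_norm)
      moreover have "\<eta> x - \<eta> y = (\<eta> x - a) + (a - b) - (\<eta> y - b)" by simp
      then have "norm (\<eta> x - \<eta> y) \<le> norm (\<eta> x - a) + norm (a - b) + norm (\<eta> y - b)"
        using norm_add_diff_le by metis
      ultimately show ?thesis
        using a(2) b(2) x'(2) tri[OF xy(2,1) x'X] sym[OF xy] diameter_ge_0[OF bd[OF x'(1)]] by linarith
    qed
    have "\<exists>f. lipsel (10 * C) {z \<in> X. d x z \<le> r x / 48} d F f \<and>
        (\<forall>z\<in>X. d x z \<le> r x / 48 \<longrightarrow> norm (f z - \<eta> x) \<le> r x)" if x: "x \<in> X" for x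
    proof (cases "r x = 0")
      case True
      \<comment> \<open>A ball of radius 0 has only its centre, where the constant map
        \<open>\<eta> x\<close> is a selection.\<close>
      have "z = x" if "z \<in> X" "d x z \<le> r x / 48" for z
        using tree_metric_pos[OF T x that(1)] that(2) True by auto
      moreover have "\<eta> x \<in> F x" using \<eta>G[OF x] by (auto simp: G_def Gam_def lipsel_def)
      ultimately have "lipsel (10 * C) {z \<in> X. d x z \<le> r x / 48} d F (\<lambda>_. \<eta> x)"
        using nn C by (intro lipselI) auto
      then show ?thesis using r0[OF x] by (intro exI[of _ "\<lambda>_. \<eta> x"]) simp
    next
      case False
      then have r: "0 < r x" using r0[OF x] by simp
      \<comment> \<open>Otherwise \<open>G x\<close> would be bounded with diameter at most
        \<open>2 * r x / 3\<close>, against the choice of \<open>r x\<close>. Using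
        \<open>r x / 3\<close> as the length in \<open>loc\<close> yields the radius
        \<open>r x / 48\<close> and a deviation of at most \<open>r x\<close>.\<close>
      have "\<exists>q\<in>G x. r x / 3 \<le> norm (q - \<eta> x)"
      proof (rule ccontr)
        assume "\<not> ?thesis"
        then have *: "norm (q - \<eta> x) \<le> r x / 3" if "q \<in> G x" for q using that by fastforce
        then have "G x \<subseteq> cball (\<eta> x) (r x / 3)" by (auto simp: dist_norm norm_minus_commute)
        then have "x \<in> X\<^sub>b" using x bounded_cball bounded_subset by (auto simp: X\<^sub>b_def)
        then have "r x \<le> diameter (G x)" using r_le[of x x] refl[OF x] by simp
        also have "\<dots> \<le> 2 * r x / 3"
        proof (rule diameter_le)
          fix a b assume "a \<in> G x" "b \<in> G x"
          then show "norm (a - b) \<le> 2 * r x / 3"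
            using norm_triangle_ineq4[of "a - \<eta> x" "b - \<eta> x"] *[of a] *[of b] by simp
        qed (use r in simp)
        finally show False using r by simp
      qed
      then obtain q where q: "q \<in> G x" "r x / 3 \<le> norm (q - \<eta> x)" by blast
      have "0 < r x / 3" using r by simp
      from loc[OF x this q] obtain f where f: "lipsel (10 * C) {z \<in> X. d x z \<le> r x / 3 / 16} d F f"
        "\<And>z. z \<in> X \<Longrightarrow> d x z \<le> r x / 3 / 16 \<Longrightarrow> norm (f z - \<eta> x) \<le> 2 * (r x / 3)"
        by blast
      have "norm (f z - \<eta> x) \<le> r x" if "z \<in> X" "d x z \<le> r x / 48" for z
        using f(2)[OF that(1)] that(2) r by simp
      then show ?thesis using f(1) by (intro exI[of _ f]) simp
    qed
    then obtain f where f: "\<And>x. x \<in> X \<Longrightarrow> lipsel (10 * C) {z \<in> X. d x z \<le> r x / 48} d F (f x)"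
      "\<And>x z. x \<in> X \<Longrightarrow> z \<in> X \<Longrightarrow> d x z \<le> r x / 48 \<Longrightarrow> norm (f x z - \<eta> x) \<le> r x"
      by metis
    show ?thesis
      by (rule glue_local_selections[OF T cF r0 r_lip \<eta>_near f]) (use C in auto)
  qed
qed

text \<open>Each of the two Helly steps costs at most a factor \<open>m + 3\<close>. Raising
  \<open>m\<close> by one increases the exponent by 3, which pays for this, and also enlarges the
  base.\<close>

lemma k_sharp_Suc: "(Suc m + 1) * ((Suc m + 1) * k_sharp m + 1) + 1 \<le> k_sharp (Suc m)"
proof -
  let ?k = "k_sharp m"
  have k: "1 \<le> ?k" by (simp add: k_sharp_def)
  then have "(Suc m + 1) * ?k + 1 \<le> (m + 3) * ?k" by (simp add: algebra_simps)
  then have "(Suc m + 1) * ((Suc m + 1) * ?k + 1) + 1 \<le> (Suc m + 1) * ((m + 3) * ?k) + (m + 3) * ?k"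
    using k by (intro add_mono mult_left_mono) auto
  also have "\<dots> = (m + 3) * (m + 3) * ?k" by (simp add: algebra_simps)
  also have "\<dots> \<le> (m + 3) ^ 3 * ?k" by (simp add: power3_eq_cube)
  also have "\<dots> \<le> (m + 3) ^ 3 * (m + 3) ^ (3 * m + 3)"
    unfolding k_sharp_def by (intro mult_left_mono power_mono) auto
  also have "\<dots> = k_sharp (Suc m)"
  proof -
    have "3 + (3 * m + 3) = 3 * Suc m + 3" "m + 3 = Suc m + 2" by simp_all
    then show ?thesis unfolding k_sharp_def power_add[symmetric] by presburger
  qed
  finally show ?thesis .
qed

text \<open>The constant grows by \<open>C \<mapsto> 10 * C + 5000\<close> from one dimension to the
  next.\<close>

theorem tree_metric_selection:
  "\<exists>C\<ge>1. \<forall>X d (F :: 'a \<Rightarrow> (nat \<Rightarrow>\<^sub>C real) set). tree_metric d X \<longrightarrow> (\<forall>x\<in>X. F x \<in> Conv m) \<longrightarrow>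
    (\<forall>S\<subseteq>X. card S \<le> k_sharp m \<longrightarrow> (\<exists>f. lipsel 1 S d F f)) \<longrightarrow> (\<exists>f. lipsel C X d F f)"
proof (induction m)
  \<comment> \<open>Each \<open>F x\<close> is a single point, so there is only one candidate, and
    its Lipschitz condition is checked on pairs of nodes.\<close>
  case 0
  show ?case
  proof (rule exI[of _ 1], intro conjI allI impI)
    show "1 \<le> (1::real)" by simp
  next
    fix X d and F :: "'a \<Rightarrow> (nat \<Rightarrow>\<^sub>C real) set"
    assume F: "\<forall>x\<in>X. F x \<in> Conv 0"
      and sel: "\<forall>S\<subseteq>X. card S \<le> k_sharp 0 \<longrightarrow> (\<exists>f. lipsel 1 S d F f)"
    have "\<exists>a. F x = {a}" if "x \<in> X" for x
    proof -
      have "F x \<in> Conv 0" using F that by blast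
      then obtain a where "F x \<subseteq> {a}" "F x \<noteq> {}" by (auto simp: Conv_def)
      then show ?thesis by blast
    qed
    then obtain a where a: "\<And>x. x \<in> X \<Longrightarrow> F x = {a x}" by metis
    have "lipsel 1 X d F a"
    proof (rule lipselI)
      show "a x \<in> F x" if "x \<in> X" for x using a[OF that] by simp
      fix x y assume xy: "x \<in> X" "y \<in> X"
      have "card {x, y} \<le> 2" by (simp add: card_insert_if)
      also have "(2::nat) \<le> 2 ^ 3" by simp
      also have "\<dots> = k_sharp 0" by (simp add: k_sharp_def numeral_2_eq_2)
      finally have "card {x, y} \<le> k_sharp 0" .
      moreover have "{x, y} \<subseteq> X" using xy by simp
      ultimately obtain f where f: "lipsel 1 {x, y} d F f" using sel[rule_format, of "{x, y}"] by blast
      then have "f x = a x" "f y = a y" using lipselD(1)[OF f] a xy by auto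
      then show "norm (a x - a y) \<le> 1 * d x y" using lipselD(2)[OF f, of x y] by simp
    qed
    then show "\<exists>f. lipsel 1 X d F f" by blast
  qed
next
  case (Suc m)
  then obtain C where C: "C \<ge> 1" and IH: "\<forall>X d (F :: 'a \<Rightarrow> (nat \<Rightarrow>\<^sub>C real) set). tree_metric d X \<longrightarrow>
      (\<forall>x\<in>X. F x \<in> Conv m) \<longrightarrow> (\<forall>S\<subseteq>X. card S \<le> k_sharp m \<longrightarrow> (\<exists>f. lipsel 1 S d F f)) \<longrightarrow>
      (\<exists>f. lipsel C X d F f)"
    by (elim exE conjE)
  show ?case
  proof (rule exI[of _ "10 * C + 5000"], intro conjI allI impI)
    show "1 \<le> 10 * C + 5000" using C by simp
  next
    fix X d and F :: "'a \<Rightarrow> (nat \<Rightarrow>\<^sub>C real) set"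
    assume T: "tree_metric d X" and F: "\<forall>x\<in>X. F x \<in> Conv (Suc m)"
      and sel: "\<forall>S\<subseteq>X. card S \<le> k_sharp (Suc m) \<longrightarrow> (\<exists>f. lipsel 1 S d F f)"
    show "\<exists>f. lipsel (10 * C + 5000) X d F f"
    proof (rule tree_selection_step[OF T _ IH[rule_format]])
      show "F x \<in> Conv (Suc m)" if "x \<in> X" for x using F that by blast
      show "1 \<le> k_sharp m" by (simp add: k_sharp_def)
      show "\<exists>f. lipsel 1 S d F f"
        if "S \<subseteq> X" "card S \<le> (Suc m + 1) * ((Suc m + 1) * k_sharp m + 1) + 1" for S
        using sel that k_sharp_Suc[of m] order_trans by blast
    next
      show "0 \<le> C" using C by simp
    qed
  qed
qed

subsection \<open>Isometric embedding of finite-dimensional spaces\<close>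

text \<open>The functional is defined on the whole space but controlled only on the span. Extending
  the control to \<open>b\<close> means correcting its value at \<open>b\<close> without changing it
  on \<open>span B\<close>.\<close>

lemma hahn_banach_extend_one:
  fixes \<phi> :: "'b::real_normed_vector \<Rightarrow> real"
  assumes \<phi>: "linear \<phi>" "\<And>y. y \<in> span B \<Longrightarrow> \<phi> y \<le> norm y"
  shows "\<exists>\<psi>. linear \<psi> \<and> (\<forall>y\<in>span (insert b B). \<psi> y \<le> norm y) \<and> (\<forall>y\<in>span B. \<psi> y = \<phi> y)"
proof (cases "b \<in> span B")
  case True
  then show ?thesis using \<phi> by (metis span_redundant)
next
  case False
  have key: "\<phi> y - norm (y - b) \<le> norm (z + b) - \<phi> z" if "y \<in> span B" "z \<in> span B" for y z
  proof -
    have "\<phi> y + \<phi> z \<le> norm ((y - b) + (z + b))"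
      using \<phi>(2)[OF span_add[OF that]] by (simp add: linear_add[OF \<phi>(1)])
    then show ?thesis using norm_triangle_ineq[of "y - b" "z + b"] by linarith
  qed
  \<comment> \<open>The new value at \<open>b\<close> must lie between the lower and the upper
    bounds in \<open>key\<close>; the least admissible one is chosen.\<close>
  define c where "c = Sup ((\<lambda>y. \<phi> y - norm (y - b)) ` span B)"
  have bdd: "bdd_above ((\<lambda>y. \<phi> y - norm (y - b)) ` span B)"
    using key[OF _ span_zero] by (intro bdd_aboveI2) auto
  have c1: "\<phi> y - norm (y - b) \<le> c" if "y \<in> span B" for y
    unfolding c_def using bdd that by (intro cSUP_upper) auto
  have c2: "c \<le> norm (z + b) - \<phi> z" if "z \<in> span B" for z
    unfolding c_def using key[OF _ that] span_zero by (intro cSUP_least) auto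
  obtain A where A: "A \<subseteq> B" "independent A" "B \<subseteq> span A"
    using maximal_independent_subset[of B] by blast
  have spA: "span A = span B"
    using A by (metis span_mono span_span subset_antisym)
  have "independent (insert b A)" using False A(2) spA by (intro independent_insertI) auto
  \<comment> \<open>The correction is a multiple of a functional that is 1 at \<open>b\<close> and
    vanishes on \<open>span B\<close>.\<close>
  then obtain \<kappa> where \<kappa>: "linear \<kappa>" "\<forall>x\<in>insert b A. \<kappa> x = (if x = b then 1 else 0::real)"
    using linear_independent_extend[of "insert b A" "\<lambda>x. if x = b then 1 else 0::real"] by blast
  have "\<kappa> x = 0" if "x \<in> A" for x
    using \<kappa>(2) that False span_base[of b A] spA by auto
  then have \<kappa>0: "\<kappa> y = 0" if "y \<in> span B" for y
    using linear_eq_0_on_span[OF \<kappa>(1)] that spA by blast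
  define \<psi> where "\<psi> y = \<phi> y + (c - \<phi> b) * \<kappa> y" for y
  have lin: "linear \<psi>"
    unfolding \<psi>_def using linear_add[OF \<phi>(1)] linear_add[OF \<kappa>(1)] linear_cmul[OF \<phi>(1)] linear_cmul[OF \<kappa>(1)]
    by (intro linearI) (simp_all add: algebra_simps)
  have "\<psi> x \<le> norm x" if x: "x \<in> span (insert b B)" for x
  proof -
    obtain t where t: "x - t *\<^sub>R b \<in> span B" using x span_breakdown_eq by blast
    define y where "y = x - t *\<^sub>R b"
    have y: "y \<in> span B" and xy: "x = y + t *\<^sub>R b" using t by (simp_all add: y_def)
    have "\<psi> b = c" using \<kappa>(2) by (simp add: \<psi>_def)
    moreover have "\<psi> y = \<phi> y" using \<kappa>0[OF y] by (simp add: \<psi>_def)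
    ultimately have \<psi>x: "\<psi> x = \<phi> y + t * c"
      by (simp add: xy linear_add[OF lin] linear_cmul[OF lin])
    have scaled: "(1 / s) *\<^sub>R y \<in> span B" "\<phi> ((1 / s) *\<^sub>R y) = \<phi> y / s" for s
      using y by (simp_all add: span_scale linear_cmul[OF \<phi>(1)])
    consider "t = 0" | "t > 0" | "t < 0" by linarith
    then show ?thesis
    proof cases
      case 1
      then show ?thesis using \<psi>x \<phi>(2)[OF y] by (simp add: xy)
    next
      case 2
      have "t * c \<le> t * (norm ((1 / t) *\<^sub>R y + b) - \<phi> y / t)"
        using c2[OF scaled(1), of t] 2 unfolding scaled(2) by (intro mult_left_mono) auto
      also have "\<dots> = norm (t *\<^sub>R ((1 / t) *\<^sub>R y + b)) - \<phi> y"
        using 2 by (simp add: right_diff_distrib)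
      also have "t *\<^sub>R ((1 / t) *\<^sub>R y + b) = x"
        using 2 by (simp add: xy scaleR_right_distrib)
      finally show ?thesis using \<psi>x by simp
    next
      case 3
      define s where "s = - t"
      have s: "s > 0" using 3 by (simp add: s_def)
      have le: "s * (\<phi> y / s - norm ((1 / s) *\<^sub>R y - b)) \<le> s * c"
        using c1[OF scaled(1), of s] s unfolding scaled(2) by (intro mult_left_mono) auto
      have e1: "s * (\<phi> y / s - norm ((1 / s) *\<^sub>R y - b))
          = \<phi> y - norm (s *\<^sub>R ((1 / s) *\<^sub>R y - b))"
        using s by (simp add: right_diff_distrib)
      have e2: "s *\<^sub>R ((1 / s) *\<^sub>R y - b) = x"
        using s by (simp add: xy s_def scaleR_right_diff_distrib)
      have e3: "s * c = - (t * c)" by (simp add: s_def)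
      show ?thesis using le unfolding \<psi>x e1 e2 e3 by linarith
    qed
  qed
  moreover have "\<psi> y = \<phi> y" if "y \<in> span B" for y
    using \<kappa>0[OF that] by (simp add: \<psi>_def)
  ultimately show ?thesis using lin by blast
qed

text \<open>The norming functional on the line through \<open>w\<close> is extended by one generator
  at a time. Applying the one-sided bound to \<open>- y\<close> gives the two-sided one.\<close>

lemma norming_functional_on_span:
  fixes w :: "'b::real_normed_vector"
  assumes "finite B"
  shows "\<exists>\<phi>. linear \<phi> \<and> (\<forall>y\<in>span B. \<bar>\<phi> y\<bar> \<le> norm y) \<and> \<phi> w = norm w"
proof -
  have "\<exists>\<phi>. linear \<phi> \<and> (\<forall>y\<in>span (insert w B). \<phi> y \<le> norm y) \<and> \<phi> w = norm w"
    using assms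
  proof (induction B)
    case empty
    show ?case
    proof (cases "w = 0")
      case True
      then show ?thesis by (intro exI[of _ "\<lambda>_. 0"]) (auto intro: linearI)
    next
      case False
      then have "independent {w}" by simp
      then obtain \<phi> where \<phi>: "linear \<phi>" "\<phi> w = norm w"
        using linear_independent_extend[of "{w}" norm] by auto
      have "\<phi> y \<le> norm y" if "y \<in> span {w}" for y
      proof -
        obtain k where "y = k *\<^sub>R w" using \<open>y \<in> span {w}\<close> by (auto simp: span_singleton)
        then show ?thesis using \<phi> by (simp add: linear_cmul mult_right_mono)
      qed
      then show ?thesis using \<phi> by blast
    qed
  next
    case (insert b B)
    then obtain \<phi> where \<phi>: "linear \<phi>" "\<And>y. y \<in> span (insert w B) \<Longrightarrow> \<phi> y \<le> norm y" "\<phi> w = norm w"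
      by blast
    obtain \<psi> where "linear \<psi>" "\<forall>y\<in>span (insert b (insert w B)). \<psi> y \<le> norm y"
      "\<forall>y\<in>span (insert w B). \<psi> y = \<phi> y"
      using hahn_banach_extend_one[OF \<phi>(1,2), of "insert w B" b] by blast
    then show ?case
      using \<phi>(3) span_base[of w "insert w B"] by (intro exI[of _ \<psi>]) (simp add: insert_commute)
  qed
  then obtain \<phi> where \<phi>: "linear \<phi>" "\<And>y. y \<in> span (insert w B) \<Longrightarrow> \<phi> y \<le> norm y" "\<phi> w = norm w"
    by blast
  have "\<bar>\<phi> y\<bar> \<le> norm y" if y: "y \<in> span B" for y
  proof -
    have "y \<in> span (insert w B)" using y span_mono[of B "insert w B"] by blast
    then show ?thesis
      using \<phi>(2)[of y] \<phi>(2)[of "- y"] by (simp add: span_neg linear_neg[OF \<phi>(1)] abs_le_iff)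
  qed
  then show ?thesis using \<phi> by blast
qed

text \<open>Rational linear combinations of the generators.\<close>

lemma countable_dense_subset_span:
  fixes B :: "'b::real_normed_vector set"
  assumes "finite B"
  shows "\<exists>D. countable D \<and> D \<noteq> {} \<and> D \<subseteq> span B \<and> (\<forall>w\<in>span B. \<forall>e>0. \<exists>v\<in>D. norm (w - v) < e)"
  using assms
proof (induction B)
  case empty
  show ?case by (intro exI[of _ "{0}"]) auto
next
  case (insert b B)
  then obtain D where D: "countable D" "D \<noteq> {}" "D \<subseteq> span B"
    "\<And>w e. w \<in> span B \<Longrightarrow> 0 < e \<Longrightarrow> \<exists>v\<in>D. norm (w - v) < e"
    by metis
  define D' where "D' = (\<lambda>(v, q). v + real_of_rat q *\<^sub>R b) ` (D \<times> UNIV)"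
  have "countable D'" unfolding D'_def using D(1) by (intro countable_image countable_SIGMA) auto
  moreover have "D' \<noteq> {}" using D(2) by (auto simp: D'_def)
  moreover have "D' \<subseteq> span (insert b B)"
  proof
    fix y assume "y \<in> D'"
    then obtain v q where v: "v \<in> D" "y = v + real_of_rat q *\<^sub>R b" by (auto simp: D'_def)
    have "v \<in> span (insert b B)" using v(1) D(3) span_mono[of B "insert b B"] by blast
    moreover have "real_of_rat q *\<^sub>R b \<in> span (insert b B)" by (intro span_scale span_base) simp
    ultimately show "y \<in> span (insert b B)" unfolding v(2) by (rule span_add)
  qed
  moreover have "\<exists>v\<in>D'. norm (w - v) < e" if w: "w \<in> span (insert b B)" and e: "0 < e" for w e
  proof -
    obtain k where "w - k *\<^sub>R b \<in> span B" using w span_breakdown_eq by blast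
    then obtain v where v: "v \<in> D" "norm (w - k *\<^sub>R b - v) < e / 2"
      using D(4)[of _ "e / 2"] e by auto
    define K where "K = norm b + 1"
    define \<delta> where "\<delta> = e / (2 * K)"
    have K: "0 < K" by (simp add: K_def add_nonneg_pos)
    then have \<delta>: "0 < \<delta>" using e by (simp add: \<delta>_def)
    obtain q where q: "k < real_of_rat q" "real_of_rat q < k + \<delta>"
      using of_rat_dense[of k "k + \<delta>"] \<delta> by auto
    have "norm ((k - real_of_rat q) *\<^sub>R b) \<le> \<delta> * norm b"
      using q by (auto intro!: mult_right_mono)
    also have "\<dots> \<le> \<delta> * K" using \<delta> by (intro mult_left_mono) (auto simp: K_def)
    also have "\<dots> = e / 2" using K by (simp add: \<delta>_def)
    finally have "norm ((k - real_of_rat q) *\<^sub>R b) \<le> e / 2" .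
    moreover have "w - (v + real_of_rat q *\<^sub>R b) = (w - k *\<^sub>R b - v) + (k - real_of_rat q) *\<^sub>R b"
      by (simp add: algebra_simps)
    then have "norm (w - (v + real_of_rat q *\<^sub>R b))
        \<le> norm (w - k *\<^sub>R b - v) + norm ((k - real_of_rat q) *\<^sub>R b)"
      using norm_triangle_ineq by metis
    ultimately have "norm (w - (v + real_of_rat q *\<^sub>R b)) < e" using v(2) by linarith
    moreover have "v + real_of_rat q *\<^sub>R b \<in> D'" using v(1) by (force simp: D'_def)
    ultimately show ?thesis by blast
  qed
  ultimately show ?case by blast
qed

text \<open>The coordinates of \<open>T y\<close> are the values of functionals that norm the
  members of a countable dense set.\<close>

lemma isometry_into_bounded_sequences:
  fixes B :: "'b::real_normed_vector set"
  assumes "finite B"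
  shows "\<exists>T :: 'b \<Rightarrow> (nat \<Rightarrow>\<^sub>C real). linear T \<and> (\<forall>y\<in>span B. norm (T y) = norm y)"
proof -
  obtain D where D: "countable D" "D \<noteq> {}" "D \<subseteq> span B"
    "\<And>w e. w \<in> span B \<Longrightarrow> 0 < e \<Longrightarrow> \<exists>v\<in>D. norm (w - v) < e"
    using countable_dense_subset_span[OF assms] by metis
  have "\<forall>w. \<exists>\<phi>. linear \<phi> \<and> (\<forall>y\<in>span B. \<bar>\<phi> y\<bar> \<le> norm y) \<and> \<phi> w = norm w"
    using norming_functional_on_span[OF assms] by blast
  then obtain \<phi> where \<phi>: "\<And>w. linear (\<phi> w)" "\<And>w y. y \<in> span B \<Longrightarrow> \<bar>\<phi> w y\<bar> \<le> norm y"
    "\<And>w. \<phi> w w = norm w"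
    by metis
  obtain A where A: "A \<subseteq> B" "independent A" "B \<subseteq> span A"
    using maximal_independent_subset[of B] by blast
  have spA: "span A = span B"
    using A by (metis span_mono span_span subset_antisym)
  \<comment> \<open>The functionals are bounded by the norm only on \<open>span B\<close>.
    Projecting there first makes the sequence bounded for every \<open>y\<close>, so that
    \<open>T\<close> is linear on the whole space.\<close>
  obtain \<pi> :: "'b \<Rightarrow> 'b" where \<pi>: "linear \<pi>" "\<forall>x\<in>A. \<pi> x = id x" "range \<pi> = span (id ` A)"
    using linear_independent_extend_subspace[OF A(2), of id] by blast
  have \<pi>B: "\<pi> y \<in> span B" for y using \<pi>(3) spA by auto
  have \<pi>id: "\<pi> y = y" if "y \<in> span B" for y
    using linear_eq_on_span[OF \<pi>(1) linear_id, of A y] \<pi>(2) that spA by auto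
  define T where "T y = Bcontfun (\<lambda>n. \<phi> (from_nat_into D n) (\<pi> y))" for y
  have T: "apply_bcontfun (T y) n = \<phi> (from_nat_into D n) (\<pi> y)" for y n
  proof -
    have "(\<lambda>n::nat. \<phi> (from_nat_into D n) (\<pi> y)) \<in> bcontfun"
      using \<phi>(2)[OF \<pi>B] by (intro bcontfun_normI[where b = "norm (\<pi> y)"]) auto
    then show ?thesis unfolding T_def by (simp add: Bcontfun_inverse)
  qed
  have "linear T"
    by (intro linearI bcontfun_eqI)
      (simp_all add: T linear_add[OF \<pi>(1)] linear_cmul[OF \<pi>(1)] linear_add[OF \<phi>(1)] linear_cmul[OF \<phi>(1)])
  moreover have "norm (T y) = norm y" if y: "y \<in> span B" for y
  proof (rule antisym)
    show "norm (T y) \<le> norm y"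
      by (rule norm_bound) (use \<phi>(2)[OF y] in \<open>simp add: T \<pi>id[OF y]\<close>)
    \<comment> \<open>If \<open>v\<close> is in the dense set and close to \<open>y\<close>, the
      functional norming \<open>v\<close> almost attains \<open>norm y\<close> at
      \<open>y\<close>.\<close>
    show "norm y \<le> norm (T y)"
    proof (rule field_le_epsilon)
      fix e :: real assume e: "0 < e"
      then obtain v where v: "v \<in> D" "norm (y - v) < e / 2" using D(4)[OF y, of "e / 2"] by auto
      obtain n where n: "from_nat_into D n = v"
        using from_nat_into_surj[OF D(1) v(1)] by blast
      have "y - v \<in> span B" using y v(1) D(3) by (auto intro: span_diff)
      then have "\<bar>\<phi> v y - \<phi> v v\<bar> \<le> norm (y - v)"
        using \<phi>(2)[of "y - v" v] by (simp add: linear_diff[OF \<phi>(1)])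
      moreover have "\<bar>\<phi> v y\<bar> \<le> norm (T y)"
        using norm_bounded[of "T y" n] by (simp add: T n \<pi>id[OF y])
      moreover have "norm y \<le> norm v + norm (y - v)"
        using norm_triangle_ineq[of v "y - v"] by simp
      ultimately show "norm y \<le> norm (T y) + e"
        using v(2) unfolding \<phi>(3) by linarith
    qed
  qed
  ultimately show ?thesis by blast
qed

lemma Conv_linear_image:
  assumes T: "linear T" and S: "S \<in> Conv m"
  shows "T ` S \<in> Conv m"
proof -
  obtain a B where B: "finite B" "card B \<le> m" "S \<subseteq> {a + v |v. v \<in> span B}"
    using S by (auto simp: Conv_def)
  obtain A where A: "A \<subseteq> T ` B" "independent A" "T ` B \<subseteq> span A"
    using maximal_independent_subset[of "T ` B"] by blast
  have "T ` span B \<subseteq> span A"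
    using A(3) by (metis T linear_span_image span_minimal subspace_span)
  then have "T ` S \<subseteq> {T a + v |v. v \<in> span A}"
    using B(3) linear_add[OF T] by fastforce
  moreover have "finite A" "card A \<le> m"
    using A(1) B(1,2) card_mono[OF _ A(1)] card_image_le[OF B(1), of T] finite_subset by fastforce+
  moreover have "convex (T ` S)" "T ` S \<noteq> {}"
    using S convex_linear_image[OF T] by (auto simp: Conv_def)
  ultimately show ?thesis using A(2) unfolding Conv_def by blast
qed

subsection \<open>Paths in finite trees\<close>

lemma path_edges_append: "path_edges (xs @ y # ys) = path_edges (xs @ [y]) @ path_edges (y # ys)"
proof (induction xs)
  case (Cons x xs)
  then show ?case by (cases xs) auto
qed simp

lemma path_edges_map: "path_edges (map g p) = map ((`) g) (path_edges p)"
  by (induction p rule: path_edges.induct) auto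

lemma path_edges_rev: "path_edges (rev p) = rev (path_edges p)"
proof (induction p rule: path_edges.induct)
  case (1 u v p)
  then show ?case
    using path_edges_append[of "rev p" v "[u]"] by (simp add: insert_commute)
qed auto

lemma path_vertex_in_edge: "2 \<le> length p \<Longrightarrow> x \<in> set p \<Longrightarrow> \<exists>e\<in>set (path_edges p). x \<in> e"
proof (induction p rule: path_edges.induct)
  case (1 u v p)
  show ?case
  proof (cases "x \<in> {u, v}")
    case False
    then have "2 \<le> length (v # p)" "x \<in> set (v # p)" using "1.prems" by (cases p; auto)+
    then show ?thesis using "1.IH" by auto
  qed auto
qed auto

lemma path_edges_crossing:
  "p \<noteq> [] \<Longrightarrow> hd p \<in> S \<Longrightarrow> last p \<notin> S \<Longrightarrow> \<exists>u v. u \<in> S \<and> v \<notin> S \<and> v \<in> set p \<and> {u, v} \<in> set (path_edges p)"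
proof (induction p rule: path_edges.induct)
  case (1 u v p)
  show ?case
  proof (cases "v \<in> S")
    case True
    then have "\<exists>u' v'. u' \<in> S \<and> v' \<notin> S \<and> v' \<in> set (v # p) \<and> {u', v'} \<in> set (path_edges (v # p))"
      using "1.prems" by (intro "1.IH") auto
    then show ?thesis by auto
  next
    case False
    then show ?thesis using "1.prems" by auto
  qed
qed auto

text \<open>Common first steps are removed by induction. Where the paths separate, they enclose a
  cycle up to the first node at which they meet again.\<close>

lemma simple_path_unique:
  assumes acyclic: "\<not> (\<exists>p. graph_cycle E p)"
  shows "simple_path X E x p y \<Longrightarrow> simple_path X E x q y \<Longrightarrow> p = q"
proof (induction p arbitrary: x q)
  case Nil
  then show ?case by (simp add: simple_path_def)
next
  case (Cons x' p')
  have x': "x' = x" using Cons.prems(1) by (simp add: simple_path_def)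
  obtain q' where q: "q = x # q'"
    using Cons.prems(2) by (cases q) (auto simp: simple_path_def)
  note P = Cons.prems(1)[unfolded x'] and Q = Cons.prems(2)[unfolded q]
  show ?case
  proof (cases "x = y")
    case True
    then have "p' = []" "q' = []"
      using P Q last_in_set[of p'] last_in_set[of q'] unfolding simple_path_def by (auto split: if_splits)
    then show ?thesis by (simp add: x' q)
  next
    case False
    then have ne: "p' \<noteq> []" "q' \<noteq> []" using P Q by (auto simp: simple_path_def)
    then obtain a pa b qb where ab: "p' = a # pa" "q' = b # qb" by (meson list.exhaust)
    show ?thesis
    proof (cases "a = b")
      case True
      have "simple_path X E a p' y" "simple_path X E a q' y"
        using P Q ab True by (auto simp: simple_path_def)
      then show ?thesis using Cons.IH by (simp add: x' q)
    next
      case False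
      have "y \<in> set p'" "y \<in> set q'"
        using P Q ne last_in_set[of p'] last_in_set[of q'] by (auto simp: simple_path_def)
      then obtain p1 v p2 where p1: "p' = p1 @ v # p2" "v \<in> set q'" "\<forall>u\<in>set p1. u \<notin> set q'"
        using split_list_first_prop[of p' "\<lambda>v. v \<in> set q'"] by blast
      obtain q1 q2 where q1: "q' = q1 @ v # q2" using split_list[OF p1(2)] by blast
      \<comment> \<open>From \<open>x\<close> along the first path to the meeting node
        \<open>v\<close>, then backwards along the second path to its second node \<open>b\<close>;
        the edge between \<open>b\<close> and \<open>x\<close> closes the cycle. As \<open>a\<close>
        differs from \<open>b\<close>, it has at least three nodes.\<close>
      define c where "c = x # p1 @ v # rev q1"
      have "p1 \<noteq> [] \<or> q1 \<noteq> []" using ab False p1(1) q1 by auto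
      then have "3 \<le> length c" by (cases p1; cases q1) (auto simp: c_def)
      moreover have "distinct c"
        using P Q p1 q1 by (auto simp: c_def simple_path_def)
      moreover have "set (path_edges c) \<subseteq> E"
      proof -
        have "path_edges c = path_edges ((x # p1) @ [v]) @ path_edges (v # rev q1)"
          unfolding c_def using path_edges_append[of "x # p1" v "rev q1"] by simp
        moreover have "set (path_edges ((x # p1) @ [v])) \<subseteq> E"
          using P path_edges_append[of "x # p1" v p2] by (simp add: simple_path_def p1(1))
        moreover have "set (path_edges (v # rev q1)) \<subseteq> E"
        proof -
          have "path_edges (v # rev q1) = rev (path_edges (q1 @ [v]))"
            using path_edges_rev[of "q1 @ [v]"] by simp
          moreover have "set (path_edges (q1 @ [v])) \<subseteq> set (path_edges ((x # q1) @ [v]))"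
            by (cases q1) auto
          moreover have "set (path_edges ((x # q1) @ [v])) \<subseteq> E"
            using Q path_edges_append[of "x # q1" v q2] by (simp add: simple_path_def q1)
          ultimately show ?thesis by auto
        qed
        ultimately show ?thesis by auto
      qed
      moreover have "{last c, hd c} \<in> E"
      proof -
        have "last c = b"
          using ab(2) q1 by (cases q1) (auto simp: c_def)
        then show ?thesis using Q ab(2) by (simp add: c_def simple_path_def insert_commute)
      qed
      ultimately have "graph_cycle E c" by (simp add: graph_cycle_def)
      then show ?thesis using acyclic by blast
    qed
  qed
qed

lemma tree_dist_eq:
  assumes "finite_tree X E" "simple_path X E x p y"
  shows "tree_dist X E \<Delta> x y = sum_list (map \<Delta> (path_edges p))"
proof -
  have uniq: "q = p" if "simple_path X E x q y" for q
    using simple_path_unique[OF _ that assms(2)] assms(1) by (simp add: finite_tree_def)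
  show ?thesis
  proof (cases "x = y")
    case True
    have "simple_path X E x [x] y"
      using assms(2) True by (cases p) (auto simp: simple_path_def)
    then have "p = [x]" using uniq by blast
    then show ?thesis using True by (simp add: tree_dist_def)
  next
    case False
    have "(THE q. simple_path X E x q y) = p" using assms(2) uniq by (rule the_equality)
    then show ?thesis using False by (simp add: tree_dist_def)
  qed
qed

lemma simple_path_rev: "simple_path X E x p y \<Longrightarrow> simple_path X E y (rev p) x"
  by (auto simp: simple_path_def path_edges_rev hd_rev last_rev)

text \<open>A maximal set of nodes is taken on which the distance is a tree metric and which
  contains paths between its members. If it were not everything, an edge leaving it would attach a
  further leaf.\<close>

theorem tree_metric_tree_dist:
  assumes T: "finite_tree X E" and \<Delta>: "\<And>e. e \<in> E \<Longrightarrow> 0 < \<Delta> e"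
  shows "tree_metric (tree_dist X E \<Delta>) X"
proof -
  let ?d = "tree_dist X E \<Delta>"
  have finX: "finite X" and conn: "\<And>x y. x \<in> X \<Longrightarrow> y \<in> X \<Longrightarrow> \<exists>p. simple_path X E x p y"
    using T by (auto simp: finite_tree_def)
  obtain o' where o': "o' \<in> X" using T by (auto simp: finite_tree_def)
  define \<S> where "\<S> = {S. S \<subseteq> X \<and> tree_metric ?d S \<and>
    (\<forall>x\<in>S. \<forall>y\<in>S. \<exists>p. simple_path X E x p y \<and> set p \<subseteq> S)}"
  have refl: "?d x x = 0" for x by (simp add: tree_dist_def)
  have "{o'} \<in> \<S>"
  proof -
    have "simple_path X E o' [o'] o'" using o' by (simp add: simple_path_def)
    then show ?thesis
      using o' tree_metric.single[of ?d o', OF refl] by (auto simp: \<S>_def intro!: exI[of _ "[o']"])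
  qed
  moreover have "finite \<S>" using finX by (auto simp: \<S>_def intro: finite_subset[of _ "Pow X"])
  ultimately obtain S where S: "S \<in> \<S>" and max: "\<And>S'. S' \<in> \<S> \<Longrightarrow> S \<subseteq> S' \<Longrightarrow> S = S'"
    using finite_has_maximal[of \<S>] by blast
  have SX: "S \<subseteq> X" and TS: "tree_metric ?d S"
    and paths: "\<And>x y. x \<in> S \<Longrightarrow> y \<in> S \<Longrightarrow> \<exists>p. simple_path X E x p y \<and> set p \<subseteq> S"
    using S by (auto simp: \<S>_def)
  have "S = X"
  proof (rule ccontr)
    assume "S \<noteq> X"
    then obtain b where b: "b \<in> X" "b \<notin> S" using SX by blast
    obtain a where a: "a \<in> S" using tree_metric_nonempty[OF TS] by blast
    obtain q where q: "simple_path X E a q b" using conn a SX b by blast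
    then obtain p z where pz: "p \<in> S" "z \<notin> S" "z \<in> set q" "{p, z} \<in> set (path_edges q)"
      using path_edges_crossing[of q S] a b by (auto simp: simple_path_def)
    have zX: "z \<in> X" and E: "{p, z} \<in> E" using pz q by (auto simp: simple_path_def)
    \<comment> \<open>Prefixing \<open>z\<close> to a path inside \<open>S\<close> keeps its nodes
      distinct. By uniqueness of paths it is the path from \<open>z\<close>, so the distance from
      \<open>z\<close> is that from \<open>p\<close> plus the length of the edge.\<close>
    have ext: "\<exists>r. simple_path X E p r y \<and> set r \<subseteq> S \<and> simple_path X E z (z # r) y
        \<and> path_edges (z # r) = {z, p} # path_edges r" if y: "y \<in> S" for y
    proof -
      obtain r where r: "simple_path X E p r y" "set r \<subseteq> S" using paths[OF pz(1) y] by blast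
      then obtain r' where r': "r = p # r'" by (cases r) (auto simp: simple_path_def)
      have "simple_path X E z (z # r) y"
        using r pz(2) zX E by (auto simp: simple_path_def r' insert_commute)
      then show ?thesis using r by (intro exI[of _ r]) (simp add: r')
    qed
    have dz: "?d z y = \<Delta> {z, p} + ?d p y" "?d y z = ?d z y" if y: "y \<in> S" for y
    proof -
      obtain r where r: "simple_path X E p r y" "simple_path X E z (z # r) y"
        "path_edges (z # r) = {z, p} # path_edges r" using ext[OF y] by blast
      show "?d z y = \<Delta> {z, p} + ?d p y"
        unfolding tree_dist_eq[OF T r(1)] tree_dist_eq[OF T r(2)] r(3) by simp
      show "?d y z = ?d z y"
        unfolding tree_dist_eq[OF T simple_path_rev[OF r(2)]] tree_dist_eq[OF T r(2)] path_edges_rev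
        by (simp only: rev_map[symmetric] sum_list_rev)
    qed
    have zp: "?d z p = \<Delta> {z, p}" using dz(1)[OF pz(1)] refl by simp
    have "tree_metric ?d (insert z S)"
    proof (rule tree_metric.leaf[OF TS pz(1,2) refl])
      show "0 < ?d z p" unfolding zp using \<Delta>[OF E] by (simp add: insert_commute)
      show "?d z y = ?d z p + ?d p y" if "y \<in> S" for y unfolding zp by (rule dz(1)[OF that])
      show "?d y z = ?d z y" if "y \<in> S" for y by (rule dz(2)[OF that])
    qed
    moreover have "\<exists>r. simple_path X E x r y \<and> set r \<subseteq> insert z S"
      if xy: "x \<in> insert z S" "y \<in> insert z S" for x y
    proof -
      have zz: "simple_path X E z [z] z" using zX by (simp add: simple_path_def)
      have zy: "\<exists>r. simple_path X E z r y \<and> set r \<subseteq> insert z S" if y: "y \<in> S" for y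
      proof -
        obtain r where "set r \<subseteq> S" "simple_path X E z (z # r) y" using ext[OF y] by blast
        then show ?thesis by (intro exI[of _ "z # r"]) auto
      qed
      consider "x = z" "y = z" | "x = z" "y \<in> S" | "x \<in> S" "y = z" | "x \<in> S" "y \<in> S"
        using xy by blast
      then show ?thesis
      proof cases
        case 1
        then show ?thesis using zz by (intro exI[of _ "[z]"]) auto
      next
        case 2
        then show ?thesis using zy by blast
      next
        case 3
        then obtain r where "simple_path X E z r x" "set r \<subseteq> insert z S" using zy by blast
        then show ?thesis using simple_path_rev 3 by (intro exI[of _ "rev r"]) auto
      next
        case 4
        then show ?thesis using paths[of x y] by blast
      qed
    qed
    ultimately have "insert z S \<in> \<S>" using SX zX by (simp add: \<S>_def)
    then show False using max[of "insert z S"] pz(2) by blast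
  qed
  then show ?thesis using TS by simp
qed

section \<open>Relabelling the nodes of a tree\<close>

lemma simple_path_image:
  assumes "inj_on g X" "simple_path X E x p y"
  shows "simple_path (g ` X) ((`) g ` E) (g x) (map g p) (g y)"
  using assms unfolding simple_path_def
  by (auto simp: hd_map last_map path_edges_map distinct_map intro: inj_on_subset)

lemma finite_tree_image:
  assumes g: "inj_on g X" and T: "finite_tree X E"
  shows "finite_tree (g ` X) ((`) g ` E)"
proof -
  let ?h = "inv_into X g"
  have E: "e \<subseteq> X" "card e = 2" if "e \<in> E" for e using T that by (auto simp: finite_tree_def)
  have hg: "?h ` g ` e = e" if "e \<subseteq> X" for e
    using g that by (force simp: image_iff inv_into_f_f[OF g] subset_iff)
  have "\<not> graph_cycle ((`) g ` E) c" for c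
  proof
    assume c: "graph_cycle ((`) g ` E) c"
    \<comment> \<open>\<open>graph_cycle\<close> does not confine the nodes of a cycle, but each of
      them lies on an edge. This makes the inverse of \<open>g\<close> injective on the
      cycle.\<close>
    have "set c \<subseteq> g ` X"
    proof
      fix v assume "v \<in> set c"
      then obtain e where "e \<in> set (path_edges c)" "v \<in> e"
        using path_vertex_in_edge[of c v] c by (auto simp: graph_cycle_def)
      then show "v \<in> g ` X" using c E(1) unfolding graph_cycle_def by blast
    qed
    then have "inj_on ?h (set c)" by (rule inj_on_inv_into)
    moreover have pull: "?h ` e \<in> E" if "e \<in> (`) g ` E" for e
      using that hg E(1) by auto
    moreover have "{?h (last c), ?h (hd c)} \<in> E"
      using pull[of "{last c, hd c}"] c by (simp add: graph_cycle_def)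
    moreover have "c \<noteq> []" using c by (auto simp: graph_cycle_def)
    ultimately have "graph_cycle E (map ?h c)"
      using c by (auto simp: graph_cycle_def distinct_map path_edges_map hd_map last_map)
    then show False using T by (auto simp: finite_tree_def)
  qed
  moreover have "\<exists>p. simple_path (g ` X) ((`) g ` E) x p y" if "x \<in> g ` X" "y \<in> g ` X" for x y
    using simple_path_image[OF g] T that unfolding finite_tree_def by blast
  moreover have "card (g ` e) = 2" if "e \<in> E" for e
    using E[OF that] card_image[OF inj_on_subset[OF g]] by metis
  moreover have "g ` e \<subseteq> g ` X" if "e \<in> E" for e
    using E(1)[OF that] by (rule image_mono)
  ultimately show ?thesis
    using T by (auto simp: finite_tree_def)
qed

lemma tree_dist_image:
  assumes g: "inj_on g X" and T: "finite_tree X E" and xy: "x \<in> X" "y \<in> X"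
  shows "tree_dist (g ` X) ((`) g ` E) (\<lambda>e. \<Delta> (inv_into X g ` e)) (g x) (g y) = tree_dist X E \<Delta> x y"
proof -
  obtain p where p: "simple_path X E x p y" using T xy unfolding finite_tree_def by blast
  have "inv_into X g ` g ` e = e" if "e \<in> set (path_edges p)" for e
  proof -
    have "e \<subseteq> X" using p T that by (auto simp: simple_path_def finite_tree_def)
    then show ?thesis using g by (force simp: image_iff inv_into_f_f[OF g] subset_iff)
  qed
  then have "map (\<lambda>e. \<Delta> (inv_into X g ` e)) (map ((`) g) (path_edges p)) = map \<Delta> (path_edges p)"
    by simp
  then show ?thesis
    by (simp only: tree_dist_eq[OF T p] tree_dist_eq[OF finite_tree_image[OF g T] simple_path_image[OF g p]]
        path_edges_map)
qed

subsection \<open>Transfer to arbitrary trees and Banach spaces\<close>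

text \<open>The infimum is itself a Lipschitz bound: distinct nodes have positive distance, so each
  difference quotient is a lower bound of \<open>lip_consts\<close>.\<close>

lemma lip_norm_le_iff:
  assumes T: "tree_metric d X" and S: "S \<subseteq> X" and L: "L > 0"
  shows "lip_selection S d F f \<and> lip_norm S d f \<le> L \<longleftrightarrow> lipsel L S d F f"
proof
  have bdd: "bdd_below (lip_consts S d f)" by (intro bdd_belowI[of _ 0]) (auto simp: lip_consts_def)
  {
    assume f: "lipsel L S d F f"
    then have "L \<in> lip_consts S d f" using L by (auto simp: lipsel_def lip_consts_def)
    then show "lip_selection S d F f \<and> lip_norm S d f \<le> L"
      using f cInf_lower[OF _ bdd] by (auto simp: lip_selection_def lip_norm_def lipsel_def)
  next
    assume f: "lip_selection S d F f \<and> lip_norm S d f \<le> L"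
    have "norm (f x - f y) \<le> L * d x y" if xy: "x \<in> S" "y \<in> S" for x y
    proof (cases "x = y")
      case True
      then show ?thesis using tree_metric_refl[OF T, of y] xy S by auto
    next
      case False
      then have d: "0 < d x y" using tree_metric_pos[OF T] xy S by blast
      have "norm (f x - f y) / d x y \<le> Inf (lip_consts S d f)"
      proof (rule cInf_greatest)
        show "lip_consts S d f \<noteq> {}" using f by (simp add: lip_selection_def)
        fix c assume "c \<in> lip_consts S d f"
        then show "norm (f x - f y) / d x y \<le> c"
          using xy d by (simp add: lip_consts_def pos_divide_le_eq)
      qed
      also have "\<dots> \<le> L" using f by (simp add: lip_norm_def)
      finally show ?thesis using d by (simp add: pos_divide_le_eq)
    qed
    then show "lipsel L S d F f" using f by (auto simp: lipsel_def lip_selection_def)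
  }
qed

text \<open>Since \<open>gamma0\<close> is a choice, one admissible constant for nodes in
  \<open>nat\<close> is enough. Stretching the metric by \<open>L\<close> reduces to Lipschitz
  constant 1.\<close>

lemma gamma0_spec:
  "gamma0 m > 0 \<and>
    (\<forall>(X :: nat set) E \<Delta> (F :: nat \<Rightarrow> (nat \<Rightarrow>\<^sub>C real) set) L.
        finite_tree X E \<longrightarrow> (\<forall>e\<in>E. \<Delta> e > 0) \<longrightarrow> L > 0 \<longrightarrow>
        (\<forall>x\<in>X. F x \<in> Conv m) \<longrightarrow>
        (\<forall>X'\<subseteq>X. card X' \<le> k_sharp m \<longrightarrow>
           (\<exists>f. lip_selection X' (tree_dist X E \<Delta>) F f \<and>
                lip_norm X' (tree_dist X E \<Delta>) f \<le> L)) \<longrightarrow>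
        (\<exists>f. lip_selection X (tree_dist X E \<Delta>) F f \<and>
             lip_norm X (tree_dist X E \<Delta>) f \<le> gamma0 m * L))"
  unfolding gamma0_def
proof (rule someI_ex)
  obtain C where C: "C \<ge> 1" and sel: "\<forall>X d (F :: nat \<Rightarrow> (nat \<Rightarrow>\<^sub>C real) set). tree_metric d X \<longrightarrow>
      (\<forall>x\<in>X. F x \<in> Conv m) \<longrightarrow> (\<forall>S\<subseteq>X. card S \<le> k_sharp m \<longrightarrow> (\<exists>f. lipsel 1 S d F f)) \<longrightarrow>
      (\<exists>f. lipsel C X d F f)"
    using tree_metric_selection[of m] by (elim exE conjE)
  show "\<exists>\<gamma>. \<gamma> > 0 \<and>
    (\<forall>(X :: nat set) E \<Delta> (F :: nat \<Rightarrow> (nat \<Rightarrow>\<^sub>C real) set) L.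
        finite_tree X E \<longrightarrow> (\<forall>e\<in>E. \<Delta> e > 0) \<longrightarrow> L > 0 \<longrightarrow>
        (\<forall>x\<in>X. F x \<in> Conv m) \<longrightarrow>
        (\<forall>X'\<subseteq>X. card X' \<le> k_sharp m \<longrightarrow>
           (\<exists>f. lip_selection X' (tree_dist X E \<Delta>) F f \<and>
                lip_norm X' (tree_dist X E \<Delta>) f \<le> L)) \<longrightarrow>
        (\<exists>f. lip_selection X (tree_dist X E \<Delta>) F f \<and>
             lip_norm X (tree_dist X E \<Delta>) f \<le> \<gamma> * L))"
  proof (rule exI[of _ C], intro conjI allI impI)
    show "0 < C" using C by simp
  next
    fix X :: "nat set" and E \<Delta> L and F :: "nat \<Rightarrow> (nat \<Rightarrow>\<^sub>C real) set"
    let ?d = "tree_dist X E \<Delta>"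
    assume T: "finite_tree X E" and \<Delta>: "\<forall>e\<in>E. \<Delta> e > 0" and L: "L > 0"
      and F: "\<forall>x\<in>X. F x \<in> Conv m"
      and H: "\<forall>X'\<subseteq>X. card X' \<le> k_sharp m \<longrightarrow> (\<exists>f. lip_selection X' ?d F f \<and> lip_norm X' ?d f \<le> L)"
    have TM: "tree_metric ?d X" using \<Delta> by (intro tree_metric_tree_dist[OF T]) blast
    have "\<exists>f. lipsel C X (\<lambda>x y. L * ?d x y) F f"
    proof (rule sel[rule_format, OF tree_metric_scale[OF TM L]])
      show "F x \<in> Conv m" if "x \<in> X" for x using F that by blast
      show "\<exists>f. lipsel 1 S (\<lambda>x y. L * ?d x y) F f" if S: "S \<subseteq> X" "card S \<le> k_sharp m" for S
      proof -
        obtain f where "lip_selection S ?d F f \<and> lip_norm S ?d f \<le> L" using H[rule_format, OF S] by blast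
        then have "lipsel L S ?d F f" using lip_norm_le_iff[OF TM S(1) L] by blast
        then have "lipsel 1 S (\<lambda>x y. L * ?d x y) F f" by (simp add: lipsel_def)
        then show ?thesis by blast
      qed
    qed
    then obtain f where "lipsel C X (\<lambda>x y. L * ?d x y) F f" by blast
    then have "lipsel (C * L) X ?d F f" by (simp add: lipsel_def mult.assoc)
    then show "\<exists>f. lip_selection X ?d F f \<and> lip_norm X ?d f \<le> C * L"
      using lip_norm_le_iff[OF TM subset_refl, of "C * L" F f] C L by auto
  qed
qed

theorem corollary4p16:
  fixes m :: nat
  assumes "m > 0"
  shows "gamma0 m > 0 \<and>
    (\<forall>(X :: 'a set) E \<Delta> (F :: 'a \<Rightarrow> 'b::banach set) L.
        finite_tree X E \<longrightarrow> (\<forall>e\<in>E. \<Delta> e > 0) \<longrightarrow> L > 0 \<longrightarrow>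
        (\<forall>x\<in>X. F x \<in> Conv m) \<longrightarrow>
        (\<forall>X'\<subseteq>X. card X' \<le> k_sharp m \<longrightarrow>
           (\<exists>f. lip_selection X' (tree_dist X E \<Delta>) F f \<and>
                lip_norm X' (tree_dist X E \<Delta>) f \<le> L)) \<longrightarrow>
        (\<exists>f. lip_selection X (tree_dist X E \<Delta>) F f \<and>
             lip_norm X (tree_dist X E \<Delta>) f \<le> gamma0 m * L))"
proof (intro conjI allI impI)
  show \<gamma>: "gamma0 m > 0" using gamma0_spec by blast
  fix X :: "'a set" and E \<Delta> and F :: "'a \<Rightarrow> 'b set" and L
  let ?d = "tree_dist X E \<Delta>"
  assume T: "finite_tree X E" and \<Delta>: "\<forall>e\<in>E. \<Delta> e > 0" and L: "L > 0"
    and F: "\<forall>x\<in>X. F x \<in> Conv m"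
    and H: "\<forall>X'\<subseteq>X. card X' \<le> k_sharp m \<longrightarrow> (\<exists>f. lip_selection X' ?d F f \<and> lip_norm X' ?d f \<le> L)"
  have finX: "finite X" using T by (simp add: finite_tree_def)
  have TM: "tree_metric ?d X" using \<Delta> by (intro tree_metric_tree_dist[OF T]) blast
  \<comment> \<open>Finitely many sets, each in a finite-dimensional affine subspace, lie in the
    span \<open>W\<close> of one finite set. This is where the isometry \<open>I\<close> is
    available.\<close>
  have "\<forall>x\<in>X. \<exists>B. finite B \<and> F x \<subseteq> span B"
  proof
    fix x assume "x \<in> X"
    then have "F x \<in> Conv m" using F by blast
    then obtain a B where B: "finite B" "F x \<subseteq> {a + v |v. v \<in> span B}" by (auto simp: Conv_def)
    have "a + v \<in> span (insert a B)" if "v \<in> span B" for v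
      using that span_mono[of B "insert a B"] by (intro span_add span_base[of a]) auto
    then show "\<exists>B. finite B \<and> F x \<subseteq> span B" using B by (intro exI[of _ "insert a B"]) auto
  qed
  then obtain B where B: "\<And>x. x \<in> X \<Longrightarrow> finite (B x)" "\<And>x. x \<in> X \<Longrightarrow> F x \<subseteq> span (B x)" by metis
  define W where "W = (\<Union>x\<in>X. B x)"
  have "finite W" using B(1) finX by (simp add: W_def)
  then obtain I :: "'b \<Rightarrow> (nat \<Rightarrow>\<^sub>C real)" where I: "linear I" "\<And>y. y \<in> span W \<Longrightarrow> norm (I y) = norm y"
    using isometry_into_bounded_sequences[of W] by blast
  have FW: "F x \<subseteq> span W" if "x \<in> X" for x
    using B(2)[OF that] span_mono[of "B x" W] that by (auto simp: W_def)
  have iso: "norm (I y - I z) = norm (y - z)" if "y \<in> span W" "z \<in> span W" for y z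
    using I(2)[OF span_diff[OF that]] by (simp add: linear_diff[OF I(1)])
  \<comment> \<open>The tree is copied into \<open>nat\<close>, the node type for which
    \<open>gamma0\<close> was chosen; edge lengths are carried over by the inverse
    \<open>h\<close>.\<close>
  obtain g :: "'a \<Rightarrow> nat" where g: "inj_on g X" using finite_imp_inj_to_nat_seg[OF finX] by blast
  define h where "h = inv_into X g"
  have hg: "h (g x) = x" if "x \<in> X" for x using inv_into_f_f[OF g that] by (simp add: h_def)
  define E' where "E' = (`) g ` E"
  define \<Delta>' where "\<Delta>' e = \<Delta> (h ` e)" for e
  let ?d' = "tree_dist (g ` X) E' \<Delta>'"
  have T': "finite_tree (g ` X) E'" unfolding E'_def by (rule finite_tree_image[OF g T])
  have d': "?d' (g x) (g y) = ?d x y" if "x \<in> X" "y \<in> X" for x y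
    unfolding E'_def \<Delta>'_def h_def by (rule tree_dist_image[OF g T that])
  have \<Delta>'pos: "\<forall>e\<in>E'. \<Delta>' e > 0"
  proof
    fix e assume "e \<in> E'"
    then obtain e0 where e0: "e0 \<in> E" "e = g ` e0" by (auto simp: E'_def)
    then have "e0 \<subseteq> X" using T by (auto simp: finite_tree_def)
    then have "h ` g ` e0 = e0" using hg by (force simp: image_iff subset_iff)
    then show "\<Delta>' e > 0" using \<Delta> e0 by (simp add: \<Delta>'_def)
  qed
  have TM': "tree_metric ?d' (g ` X)" using \<Delta>'pos by (intro tree_metric_tree_dist[OF T']) blast
  define F' where "F' n = I ` F (h n)" for n
  have "\<exists>f. lip_selection (g ` X) ?d' F' f \<and> lip_norm (g ` X) ?d' f \<le> gamma0 m * L"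
  proof (rule gamma0_spec[THEN conjunct2, rule_format, OF T' _ L])
    show "\<Delta>' e > 0" if "e \<in> E'" for e using \<Delta>'pos that by blast
    show "F' n \<in> Conv m" if "n \<in> g ` X" for n
      using that F hg by (auto simp: F'_def intro: Conv_linear_image[OF I(1)])
    fix S' assume S': "S' \<subseteq> g ` X" "card S' \<le> k_sharp m"
    then obtain S where S: "S \<subseteq> X" "S' = g ` S" by (meson subset_imageE)
    then have "card S \<le> k_sharp m" using S'(2) card_image[OF inj_on_subset[OF g S(1)]] by simp
    then obtain f where "lip_selection S ?d F f \<and> lip_norm S ?d f \<le> L" using H[rule_format, OF S(1)] by blast
    then have f: "lipsel L S ?d F f" using lip_norm_le_iff[OF TM S(1) L] by blast
    have "lipsel L S' ?d' F' (\<lambda>n. I (f (h n)))"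
      unfolding S(2)
    proof (rule lipselI; clarify)
      fix x assume x: "x \<in> S"
      then have xX: "x \<in> X" using S by blast
      show "I (f (h (g x))) \<in> F' (g x)" using lipselD(1)[OF f x] by (simp add: F'_def hg[OF xX])
      fix y assume y: "y \<in> S"
      then have yX: "y \<in> X" using S by blast
      have "f x \<in> span W" "f y \<in> span W"
        using lipselD(1)[OF f] x y FW[OF xX] FW[OF yX] by blast+
      then show "norm (I (f (h (g x))) - I (f (h (g y)))) \<le> L * ?d' (g x) (g y)"
        using lipselD(2)[OF f x y] by (simp add: hg[OF xX] hg[OF yX] iso d'[OF xX yX])
    qed
    then have "lip_selection S' ?d' F' (\<lambda>n. I (f (h n))) \<and> lip_norm S' ?d' (\<lambda>n. I (f (h n))) \<le> L"
      using lip_norm_le_iff[OF TM' S'(1) L] by blast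
    then show "\<exists>f. lip_selection S' ?d' F' f \<and> lip_norm S' ?d' f \<le> L" by blast
  qed
  moreover have \<gamma>L: "gamma0 m * L > 0" using \<gamma> L by simp
  ultimately obtain f' where f': "lipsel (gamma0 m * L) (g ` X) ?d' F' f'"
    using lip_norm_le_iff[OF TM' subset_refl \<gamma>L] by blast
  \<comment> \<open>The selection for the copy is pulled back pointwise. Each value has a preimage
    in \<open>F x\<close>, and \<open>I\<close> preserves distances on \<open>span W\<close>, so the
    Lipschitz bound survives.\<close>
  have "\<forall>x\<in>X. \<exists>y. y \<in> F x \<and> I y = f' (g x)"
  proof
    fix x assume x: "x \<in> X"
    have "f' (g x) \<in> F' (g x)" using lipselD(1)[OF f'] x by blast
    then show "\<exists>y. y \<in> F x \<and> I y = f' (g x)" by (auto simp: F'_def hg[OF x])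
  qed
  then obtain f where f: "\<And>x. x \<in> X \<Longrightarrow> f x \<in> F x" "\<And>x. x \<in> X \<Longrightarrow> I (f x) = f' (g x)" by metis
  have "lipsel (gamma0 m * L) X ?d F f"
  proof (rule lipselI[OF f(1)])
    fix x y assume xy: "x \<in> X" "y \<in> X"
    have "f x \<in> span W" "f y \<in> span W" using f(1) xy FW by blast+
    from iso[OF this] have "norm (f x - f y) = norm (f' (g x) - f' (g y))"
      by (simp add: f(2)[OF xy(1)] f(2)[OF xy(2)])
    then show "norm (f x - f y) \<le> gamma0 m * L * ?d x y"
      using lipselD(2)[OF f', of "g x" "g y"] xy d'[OF xy] by simp
  qed
  then show "\<exists>f. lip_selection X ?d F f \<and> lip_norm X ?d f \<le> gamma0 m * L"
    using lip_norm_le_iff[OF TM subset_refl \<gamma>L] by blast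
qed

end
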